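(* Let $n,m\in\mathbb{N}$ be positive integers, and let $g:\mathbb{R}^n\to\mathbb{R}$ be the radially symmetric function $g(x)=\|x\|^m\tanh\|x\|$. For $j\ge 0$ set $$p_j=\frac{(-1)^j}{2^{2j}\,j!}\left(\sum_{k=1}^{\infty}\frac{(-1)^k}{k^{m+2j+n}}\right)\left(\prod_{i=0}^{m-1}(n+2j+i)\right)\Gamma\!\left(j+\frac{n+1}{2}\right).$$ Then the series $\sum_{j=0}^\infty p_j\|y\|^{2j}$ is absolutely convergent in the open unit ball $\{y\in\mathbb{R}^n:\|y\|<1\}$, and $g$ has a generalised Fourier transform $\hat g$ with the following expansion at zero, valid (as an identity of generalised functions) on that ball: $$\hat g(y)=\hat u(y)+2^{-m+1}\pi^{\frac{n-1}{2}}\sum_{j=0}^\infty p_j\|y\|^{2j},\qquad \|y\|<1,$$ where $\hat u$ is the generalised Fourier transform of the function $u(x)=\|x\|^m$ on $\mathbb{R}^n$.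
   Context: $\|\cdot\|$ is the Euclidean norm. Generalised Fourier transforms are Fourier transforms in the sense of tempered distributions, with the normalisation $\hat f(y)=\int_{\mathbb{R}^n}f(x)\,\mathrm{e}^{-\mathrm{i}\,y\cdot x}\,\mathrm{d}x$ for $f\in L^1(\mathbb{R}^n)$. For reference, with this normalisation the generalised Fourier transform $\hat u$ of $u(x)=\|x\|^m$ is, if $m$ is odd, given away from the origin by $$\hat u(y)=\frac{\Gamma\left(\frac{m+n}{2}\right)}{\Gamma\left(-\frac m2\right)}2^{m+n}\pi^{n/2}\|y\|^{-m-n},\qquad y\ne 0,$$ and if $m=2k$ is even, $\hat u=(2\pi)^n(-1)^k(\partial_1^2+\cdots+\partial_n^2)^k\delta$, which is supported at the origin. *)

theory Defs
  imports "HOL-Analysis.Analysis"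
begin

primrec partial_derivs ::
  "'a::euclidean_space list \<Rightarrow> ('a \<Rightarrow> complex) \<Rightarrow> 'a \<Rightarrow> complex" where
  "partial_derivs [] f = f"
| "partial_derivs (v # vs) f = (\<lambda>x. frechet_derivative (partial_derivs vs f) (at x) v)"

text \<open>Being differentiable, every iterated partial derivative is also continuous,
  so the next definition is the usual class of infinitely differentiable functions.\<close>

definition smooth :: "('a::euclidean_space \<Rightarrow> complex) \<Rightarrow> bool" where
  "smooth f \<longleftrightarrow> (\<forall>vs. set vs \<subseteq> Basis \<longrightarrow> (\<forall>x. partial_derivs vs f differentiable (at x)))"

definition schwartz_space :: "('a::euclidean_space \<Rightarrow> complex) set" where
  "schwartz_space = {\<phi>. smooth \<phi> \<and>
     (\<forall>k vs. set vs \<subseteq> Basis \<longrightarrow>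
        bdd_above (range (\<lambda>x. norm x ^ k * norm (partial_derivs vs \<phi> x))))}"

definition schwartz_seminorm ::
  "nat \<Rightarrow> 'a::euclidean_space list \<Rightarrow> ('a \<Rightarrow> complex) \<Rightarrow> real" where
  "schwartz_seminorm k vs \<phi> = (SUP x. norm x ^ k * norm (partial_derivs vs \<phi> x))"

definition schwartz_topology :: "('a::euclidean_space \<Rightarrow> complex) topology" where
  "schwartz_topology = topology_generated_by
     {{\<psi> \<in> schwartz_space. schwartz_seminorm k vs (\<lambda>x. \<psi> x - \<phi> x) < e} | \<phi> k vs e.
        \<phi> \<in> schwartz_space \<and> set vs \<subseteq> Basis \<and> e > 0}"

text \<open>Distributions are total functions on all of \<^typ>\<open>'a \<Rightarrow> complex\<close>; only their values on
  \<^const>\<open>schwartz_space\<close> are meaningful.\<close>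

definition tempered_distribution ::
  "(('a::euclidean_space \<Rightarrow> complex) \<Rightarrow> complex) \<Rightarrow> bool" where
  "tempered_distribution T \<longleftrightarrow>
     (\<forall>\<phi>\<in>schwartz_space. \<forall>\<psi>\<in>schwartz_space. T (\<lambda>x. \<phi> x + \<psi> x) = T \<phi> + T \<psi>) \<and>
     (\<forall>c. \<forall>\<phi>\<in>schwartz_space. T (\<lambda>x. c * \<phi> x) = c * T \<phi>) \<and>
     continuous_map schwartz_topology euclidean T"

definition regular_distribution ::
  "('a::euclidean_space \<Rightarrow> complex) \<Rightarrow> ('a \<Rightarrow> complex) \<Rightarrow> complex" where
  "regular_distribution f \<phi> = (LINT x|lborel. f x * \<phi> x)"

text \<open>The integrability clause is needed because the Bochner integral of a non-integrable
  function is 0 by convention.\<close>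

definition tempered_function :: "('a::euclidean_space \<Rightarrow> complex) \<Rightarrow> bool" where
  "tempered_function f \<longleftrightarrow>
     (\<forall>\<phi>\<in>schwartz_space. integrable lborel (\<lambda>x. f x * \<phi> x)) \<and>
     tempered_distribution (regular_distribution f)"

definition fourier :: "('a::euclidean_space \<Rightarrow> complex) \<Rightarrow> 'a \<Rightarrow> complex" where
  "fourier \<phi> y = (LINT x|lborel. \<phi> x * exp (- \<i> * complex_of_real (y \<bullet> x)))"

definition fourier_distribution ::
  "(('a::euclidean_space \<Rightarrow> complex) \<Rightarrow> complex) \<Rightarrow> ('a \<Rightarrow> complex) \<Rightarrow> complex" where
  "fourier_distribution T \<phi> = T (fourier \<phi>)"

definition generalised_fourier ::
  "('a::euclidean_space \<Rightarrow> complex) \<Rightarrow> ('a \<Rightarrow> complex) \<Rightarrow> complex" where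
  "generalised_fourier f = fourier_distribution (regular_distribution f)"

definition has_generalised_fourier :: "('a::euclidean_space \<Rightarrow> complex) \<Rightarrow> bool" where
  "has_generalised_fourier f \<longleftrightarrow>
     tempered_function f \<and> tempered_distribution (generalised_fourier f)"

definition test_functions :: "'a::euclidean_space set \<Rightarrow> ('a \<Rightarrow> complex) set" where
  "test_functions U = {\<phi>. smooth \<phi> \<and> compact (closure {x. \<phi> x \<noteq> 0}) \<and>
     closure {x. \<phi> x \<noteq> 0} \<subseteq> U}"

definition distributions_eq_on ::
  "'a::euclidean_space set \<Rightarrow> (('a \<Rightarrow> complex) \<Rightarrow> complex) \<Rightarrow> (('a \<Rightarrow> complex) \<Rightarrow> complex) \<Rightarrow> bool"
  where
  "distributions_eq_on U S T \<longleftrightarrow> (\<forall>\<phi>\<in>test_functions U. S \<phi> = T \<phi>)"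

text \<open>The inner series runs over \<open>k \<ge> 1\<close>, hence the shift by \<^const>\<open>Suc\<close>.\<close>

definition expansion_coeff :: "nat \<Rightarrow> nat \<Rightarrow> nat \<Rightarrow> real" where
  "expansion_coeff n m j =
     (-1) ^ j / (2 ^ (2 * j) * fact j)
     * (\<Sum>k. (-1) ^ Suc k / real (Suc k) ^ (m + 2 * j + n))
     * (\<Prod>i<m. real (n + 2 * j + i))
     * Gamma (real j + (real n + 1) / 2)"

end

theory Submission
  imports Defs "HOL-Probability.Probability"
begin

text \<open>Write \<open>r = norm x\<close>. The function \<open>g - u\<close> is \<open>r ^ m * (tanh r - 1)\<close>, which is of size
\<open>r ^ m * exp (- 2 r)\<close>. It is therefore integrable and has a classical Fourier transform, and the theorem
says that on the unit ball this transform is given by its Taylor series at zero.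

Two separate facts are combined. On the side of distributions, every measurable function of polynomial
growth has a generalised Fourier transform (\<open>polynomial_growth_has_generalised_fourier\<close>). The
Fourier transform of a Schwartz function decays faster than any power, with bounds by seminorms
(\<open>fourier_decay\<close>), so the pairing is continuous. For the integrable function \<open>g - u\<close>, Fubini
(\<open>fourier_exchange\<close>) moves the transform from the test function to \<open>g - u\<close>. What remains is an
identity of functions on the unit ball.

For that identity, the function is even, so its transform at \<open>y\<close> is the integral against
\<open>cos (x \<bullet> y)\<close>. The decay rate \<open>2\<close> exceeds \<open>norm y\<close> and allows term by term integration of the cosine
series (\<open>even_fourier_power_series\<close>). The \<open>j\<close>-th term is the integral of \<open>(x \<bullet> y) ^ (2 * j)\<close>
against a radial function. In polar coordinates it is \<open>norm y ^ (2 * j)\<close> times a moment of the unit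
sphere times a one-dimensional integral (\<open>has_bochner_integral_radial_moment\<close>). Expanding
\<open>tanh r - 1\<close> as a geometric series in \<open>exp (- 2 r)\<close> evaluates the latter by the alternating zeta
sums of the coefficients (\<open>tanh_defect_moment\<close>), and Legendre duplication brings the product
of Gamma values into the stated form (\<open>expansion_coeff_eq_moment\<close>).

Polar coordinates are needed only for homogeneous weights, where scaling alone yields them up to a
constant (\<open>distr_norm_homogeneous\<close>). Evaluating both sides at a Gaussian determines the constant.\<close>

section \<open>Schwartz functions and tempered distributions\<close>

lemma partial_derivs_append:
  "partial_derivs (vs @ ws) f = partial_derivs vs (partial_derivs ws f)"
  by (induction vs) simp_all

lemma smooth_has_derivative:
  assumes "smooth f" "set vs \<subseteq> Basis"
  shows "(partial_derivs vs f has_derivative frechet_derivative (partial_derivs vs f) (at x)) (at x)"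
  using assms unfolding smooth_def by (simp add: frechet_derivative_works)

lemma partial_derivs_lincomb:
  assumes "smooth f" "smooth g" "set vs \<subseteq> Basis"
  shows "partial_derivs vs (\<lambda>x. a * f x + b * g x) =
    (\<lambda>x. a * partial_derivs vs f x + b * partial_derivs vs g x)"
  using assms(3)
proof (induction vs)
  case (Cons v vs)
  then have IH: "partial_derivs vs (\<lambda>x. a * f x + b * g x) =
    (\<lambda>x. a * partial_derivs vs f x + b * partial_derivs vs g x)" and vs: "set vs \<subseteq> Basis"
    by auto
  have "((\<lambda>x. a * partial_derivs vs f x + b * partial_derivs vs g x) has_derivative
      (\<lambda>h. a * frechet_derivative (partial_derivs vs f) (at x) h
         + b * frechet_derivative (partial_derivs vs g) (at x) h)) (at x)" for x
    by (intro derivative_intros smooth_has_derivative assms vs)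
  then show ?case
    unfolding partial_derivs.simps IH
    by (intro ext) (subst frechet_derivative_at[symmetric], assumption, simp)
qed simp

lemma smooth_lincomb:
  assumes "smooth f" "smooth g"
  shows "smooth (\<lambda>x. a * f x + b * g x)"
  unfolding smooth_def
proof (intro allI impI)
  fix vs :: "'a list" and x
  assume vs: "set vs \<subseteq> Basis"
  have "(\<lambda>x. a * partial_derivs vs f x + b * partial_derivs vs g x) differentiable (at x)"
    using assms vs unfolding smooth_def by (intro derivative_intros) auto
  then show "partial_derivs vs (\<lambda>x. a * f x + b * g x) differentiable (at x)"
    by (simp add: partial_derivs_lincomb[OF assms vs])
qed

lemma smooth_partial_derivs:
  assumes "smooth f" "set vs \<subseteq> Basis"
  shows "smooth (partial_derivs vs f)"
  using assms unfolding smooth_def by (simp flip: partial_derivs_append)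

lemma schwartz_seminorm_upper:
  assumes "\<phi> \<in> schwartz_space" "set vs \<subseteq> Basis"
  shows "norm x ^ k * norm (partial_derivs vs \<phi> x) \<le> schwartz_seminorm k vs \<phi>"
  unfolding schwartz_seminorm_def using assms
  by (intro cSUP_upper) (auto simp: schwartz_space_def)

lemma schwartz_seminorm_nonneg:
  assumes "\<phi> \<in> schwartz_space" "set vs \<subseteq> Basis"
  shows "0 \<le> schwartz_seminorm k vs \<phi>"
  by (rule order_trans[OF _ schwartz_seminorm_upper[OF assms, of 0]]) simp

lemma schwartz_lincomb:
  assumes "f \<in> schwartz_space" "g \<in> schwartz_space"
  shows "(\<lambda>x. a * f x + b * g x) \<in> schwartz_space"
proof -
  have sm: "smooth f" "smooth g" using assms by (auto simp: schwartz_space_def)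
  have "bdd_above (range (\<lambda>x. norm x ^ k * norm (partial_derivs vs (\<lambda>x. a * f x + b * g x) x)))"
    if vs: "set vs \<subseteq> Basis" for k vs
  proof (rule bdd_aboveI2)
    fix x
    have "norm x ^ k * norm (partial_derivs vs (\<lambda>x. a * f x + b * g x) x)
      \<le> norm x ^ k * (norm a * norm (partial_derivs vs f x) + norm b * norm (partial_derivs vs g x))"
      unfolding partial_derivs_lincomb[OF sm vs]
      by (intro mult_left_mono norm_triangle_le) (auto simp: norm_mult)
    also have "\<dots> = norm a * (norm x ^ k * norm (partial_derivs vs f x))
        + norm b * (norm x ^ k * norm (partial_derivs vs g x))"
      by (simp add: algebra_simps)
    also have "\<dots> \<le> norm a * schwartz_seminorm k vs f + norm b * schwartz_seminorm k vs g"
      by (intro add_mono mult_left_mono schwartz_seminorm_upper assms vs) auto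
    finally show "norm x ^ k * norm (partial_derivs vs (\<lambda>x. a * f x + b * g x) x) \<le> \<dots>" .
  qed
  then show ?thesis using smooth_lincomb[OF sm] by (auto simp: schwartz_space_def)
qed

lemma schwartz_diff: "f \<in> schwartz_space \<Longrightarrow> g \<in> schwartz_space \<Longrightarrow> (\<lambda>x. f x - g x) \<in> schwartz_space"
  using schwartz_lincomb[of f g 1 "-1"] by simp

lemma schwartz_partial_derivs:
  assumes "\<phi> \<in> schwartz_space" "set vs \<subseteq> Basis"
  shows "partial_derivs vs \<phi> \<in> schwartz_space"
  using assms smooth_partial_derivs[of \<phi> vs]
  by (auto simp: schwartz_space_def simp flip: partial_derivs_append)

lemma schwartz_continuous:
  assumes "\<phi> \<in> schwartz_space"
  shows "continuous_on UNIV \<phi>"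
proof -
  have "\<phi> differentiable (at x)" for x
    using assms by (force simp: schwartz_space_def smooth_def dest: spec[of _ "[]"])
  then show ?thesis
    by (simp add: continuous_on_eq_continuous_at differentiable_imp_continuous_within)
qed

lemma schwartz_measurable [measurable_dest]:
  "\<phi> \<in> schwartz_space \<Longrightarrow> \<phi> \<in> borel_measurable borel"
  by (simp add: borel_measurable_continuous_onI schwartz_continuous)

lemma partial_derivs_zero: "set vs \<subseteq> Basis \<Longrightarrow> partial_derivs vs (\<lambda>x. 0) = (\<lambda>x. 0)"
  by (induction vs) simp_all

lemma topspace_schwartz: "topspace schwartz_topology = schwartz_space"
  unfolding schwartz_topology_def topology_generated_by_topspace
proof (intro equalityI subsetI)
  fix \<phi> :: "'a \<Rightarrow> complex" assume \<phi>: "\<phi> \<in> schwartz_space"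
  show "\<phi> \<in> \<Union> {{\<psi> \<in> schwartz_space. schwartz_seminorm k vs (\<lambda>x. \<psi> x - \<phi> x) < e} |\<phi> k vs e.
      \<phi> \<in> schwartz_space \<and> set vs \<subseteq> Basis \<and> 0 < e}"
  proof (rule UnionI, rule CollectI, intro exI conjI)
    show "set ([] :: 'a list) \<subseteq> Basis" "(0::real) < 1" by simp_all
    show "\<phi> \<in> {\<psi> \<in> schwartz_space. schwartz_seminorm 0 [] (\<lambda>x. \<psi> x - \<phi> x) < 1}"
      using \<phi> by (simp add: schwartz_seminorm_def)
  qed (rule refl, rule \<phi>)
qed auto

text \<open>The sets generating the topology are seminorm balls around arbitrary centres, so a linear functional
bounded by finitely many seminorms is continuous: a finite intersection of balls around \<open>\<phi>\<close> is
mapped into any prescribed ball around \<open>T \<phi>\<close>. The family is indexed so that the same seminorm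
may occur several times.\<close>

lemma tempered_distributionI:
  fixes T :: "('a::euclidean_space \<Rightarrow> complex) \<Rightarrow> complex" and C :: real
    and k :: "'i \<Rightarrow> nat" and vs :: "'i \<Rightarrow> 'a list"
  assumes add: "\<And>\<phi> \<psi>. \<phi> \<in> schwartz_space \<Longrightarrow> \<psi> \<in> schwartz_space \<Longrightarrow> T (\<lambda>x. \<phi> x + \<psi> x) = T \<phi> + T \<psi>"
    and scale: "\<And>c \<phi>. \<phi> \<in> schwartz_space \<Longrightarrow> T (\<lambda>x. c * \<phi> x) = c * T \<phi>"
    and I: "finite I" "\<And>i. i \<in> I \<Longrightarrow> set (vs i) \<subseteq> Basis"
    and bound: "\<And>\<phi>. \<phi> \<in> schwartz_space \<Longrightarrow> norm (T \<phi>) \<le> C * (\<Sum>i\<in>I. schwartz_seminorm (k i) (vs i) \<phi>)"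
  shows "tempered_distribution T"
proof -
  have nbhd: "openin schwartz_topology
      {\<psi> \<in> schwartz_space. \<forall>i\<in>J. schwartz_seminorm (k i) (vs i) (\<lambda>x. \<psi> x - \<phi> x) < d}"
    if \<phi>: "\<phi> \<in> schwartz_space" and d: "d > 0" and "finite J" "J \<subseteq> I" for \<phi> d J
    using that(3,4)
  proof induction
    case empty
    show ?case using openin_topspace[of schwartz_topology] by (simp add: topspace_schwartz)
  next
    case (insert i J)
    then have IH: "openin schwartz_topology
        {\<psi> \<in> schwartz_space. \<forall>i\<in>J. schwartz_seminorm (k i) (vs i) (\<lambda>x. \<psi> x - \<phi> x) < d}"
      and vs: "set (vs i) \<subseteq> Basis" using I(2) by auto
    have "openin schwartz_topology {\<psi> \<in> schwartz_space. schwartz_seminorm (k i) (vs i) (\<lambda>x. \<psi> x - \<phi> x) < d}"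
      unfolding schwartz_topology_def using \<phi> vs d by (intro topology_generated_by_Basis) blast
    from openin_Int[OF this IH] show ?case
      by (rule back_subst[of "openin schwartz_topology"]) auto
  qed
  have "continuous_map schwartz_topology euclidean T"
    unfolding continuous_map
  proof (intro conjI allI impI)
    fix U :: "complex set" assume "openin euclidean U"
    then have U: "open U" by simp
    show "openin schwartz_topology {\<phi> \<in> topspace schwartz_topology. T \<phi> \<in> U}"
      unfolding topspace_schwartz
    proof (subst openin_subopen, intro ballI)
      fix \<phi> assume "\<phi> \<in> {\<phi> \<in> schwartz_space. T \<phi> \<in> U}"
      then have \<phi>: "\<phi> \<in> schwartz_space" and "T \<phi> \<in> U" by auto
      with U obtain e where e: "e > 0" "ball (T \<phi>) e \<subseteq> U" by (meson openE)
      define d where "d = e / (\<bar>C\<bar> * card I + 1)"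
      have pos: "\<bar>C\<bar> * card I + 1 > 0" by (intro add_nonneg_pos) auto
      then have d: "d > 0" unfolding d_def using e by (intro divide_pos_pos)
      let ?N = "{\<psi> \<in> schwartz_space. \<forall>i\<in>I. schwartz_seminorm (k i) (vs i) (\<lambda>x. \<psi> x - \<phi> x) < d}"
      have "T \<psi> \<in> U" if "\<psi> \<in> ?N" for \<psi>
      proof -
        have \<psi>: "\<psi> \<in> schwartz_space" using that by simp
        let ?\<delta> = "\<lambda>x. \<psi> x - \<phi> x"
        have \<delta>: "?\<delta> \<in> schwartz_space" using schwartz_diff[OF \<psi> \<phi>] .
        have "T \<psi> = T ?\<delta> + T \<phi>" using add[OF \<delta> \<phi>] by simp
        then have "dist (T \<phi>) (T \<psi>) = norm (T ?\<delta>)" by (simp add: dist_norm norm_minus_commute)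
        also have "\<dots> \<le> C * (\<Sum>i\<in>I. schwartz_seminorm (k i) (vs i) ?\<delta>)" by (rule bound[OF \<delta>])
        also have "\<dots> \<le> \<bar>C\<bar> * (\<Sum>i\<in>I. schwartz_seminorm (k i) (vs i) ?\<delta>)"
          by (intro mult_right_mono sum_nonneg schwartz_seminorm_nonneg[OF \<delta>] I(2)) (rule abs_ge_self)
        also have "\<dots> \<le> \<bar>C\<bar> * (real (card I) * d)"
        proof (intro mult_left_mono sum_bounded_above)
          fix i assume "i \<in> I"
          then have "schwartz_seminorm (k i) (vs i) ?\<delta> < d" using that by blast
          then show "schwartz_seminorm (k i) (vs i) ?\<delta> \<le> d" by (rule less_imp_le)
        qed simp
        also have "\<dots> < (\<bar>C\<bar> * card I + 1) * d" using d by (simp add: algebra_simps)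
        also have "\<dots> = e" using pos by (simp add: d_def)
        finally have "T \<psi> \<in> ball (T \<phi>) e" by simp
        then show ?thesis using e(2) by blast
      qed
      moreover have "\<phi> \<in> ?N"
        using \<phi> d by (simp add: schwartz_seminorm_def partial_derivs_zero[OF I(2)])
      ultimately show "\<exists>N. openin schwartz_topology N \<and> \<phi> \<in> N \<and> N \<subseteq> {\<phi> \<in> schwartz_space. T \<phi> \<in> U}"
        using nbhd[OF \<phi> d I(1) order_refl] by (intro exI[of _ ?N] conjI subsetI) auto
    qed
  qed simp
  then show ?thesis
    unfolding tempered_distribution_def by (intro conjI ballI allI add scale)
qed

section \<open>An integrable weight dominating Schwartz functions\<close>

text \<open>Lebesgue measure on a Euclidean space is the image of the product of the one-dimensional ones, so
that Fubini factorises integrals of products of functions of the coordinates. This serves twice: for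
the weight below and for the Gaussian.\<close>
lemma
  fixes f :: "'a::euclidean_space \<Rightarrow> real \<Rightarrow> 'b::{real_normed_field, banach, second_countable_topology}"
  assumes "\<And>b. b \<in> Basis \<Longrightarrow> integrable lborel (f b)"
  shows integrable_lborel_prod: "integrable lborel (\<lambda>x::'a. \<Prod>b\<in>Basis. f b (x \<bullet> b))"
    and integral_lborel_prod: "(LINT x|lborel. (\<Prod>b\<in>(Basis::'a set). f b (x \<bullet> b))) = (\<Prod>b\<in>Basis. integral\<^sup>L lborel (f b))"
proof -
  interpret product_sigma_finite "\<lambda>_::'a. lborel :: real measure" by standard
  let ?E = "\<lambda>g. \<Sum>c\<in>(Basis::'a set). g c *\<^sub>R c"
  have f: "f b \<in> borel_measurable borel" if "b \<in> Basis" for b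
    using borel_measurable_integrable[OF assms[OF that]] by simp
  have E: "?E \<in> measurable (Pi\<^sub>M Basis (\<lambda>_. lborel)) borel" by measurable
  have meas: "(\<lambda>x::'a. \<Prod>b\<in>Basis. f b (x \<bullet> b)) \<in> borel_measurable borel"
  proof (intro borel_measurable_prod)
    fix b :: 'a assume "b \<in> Basis"
    moreover have "(\<lambda>x. x \<bullet> b) \<in> borel_measurable borel" by measurable
    ultimately show "(\<lambda>x. f b (x \<bullet> b)) \<in> borel_measurable borel"
      by (rule measurable_compose[OF _ f, rotated])
  qed
  have eq: "(\<Prod>b\<in>Basis. f b (?E g \<bullet> b)) = (\<Prod>b\<in>Basis. f b (g b))" for g
    by (intro prod.cong) auto
  show "integrable lborel (\<lambda>x::'a. \<Prod>b\<in>Basis. f b (x \<bullet> b))"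
    unfolding lborel_eq[where ?'a='a] integrable_distr_eq[OF E meas] eq
    by (rule product_integrable_prod[OF finite_Basis assms])
  show "(LINT x|lborel. (\<Prod>b\<in>(Basis::'a set). f b (x \<bullet> b))) = (\<Prod>b\<in>Basis. integral\<^sup>L lborel (f b))"
    unfolding lborel_eq[where ?'a='a] integral_distr[OF E meas] eq
    by (rule product_integral_prod[OF finite_Basis assms])
qed

text \<open>The product form, rather than a power of \<open>1 + norm x\<close>, makes the weight integrable by Fubini
without any prior use of polar coordinates.\<close>

definition decay_weight :: "'a::euclidean_space \<Rightarrow> real" where
  "decay_weight x = (\<Prod>b\<in>Basis. inverse (1 + (x \<bullet> b)\<^sup>2))"

lemma integrable_decay_weight: "integrable lborel (decay_weight :: 'a::euclidean_space \<Rightarrow> real)"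
  unfolding decay_weight_def
  using integrable_inverse_1_plus_square
  by (intro integrable_lborel_prod) (simp add: set_integrable_def)

lemma borel_measurable_decay_weight [measurable]: "decay_weight \<in> borel_measurable borel"
  using borel_measurable_integrable[OF integrable_decay_weight] by simp

lemma decay_weight_pos: "0 < decay_weight x"
  unfolding decay_weight_def by (intro prod_pos) (simp add: add_pos_nonneg)

lemma integral_decay_weight_nonneg: "0 \<le> integral\<^sup>L lborel decay_weight"
  by (intro integral_nonneg_AE AE_I2 less_imp_le decay_weight_pos)

text \<open>A difference quotient of a function is bounded by a derivative at a nearby point. Since only the
factor of direction \<open>b\<close> changes, and \<open>1 + (z - s)\<^sup>2 \<le> 3 (1 + z\<^sup>2)\<close> for \<open>\<bar>s\<bar> \<le> 1\<close>, the weight at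
the original point still dominates.\<close>

lemma decay_weight_shift:
  assumes "0 \<le> s" "s \<le> 1" "b \<in> Basis"
  shows "decay_weight (x + s *\<^sub>R b) \<le> 3 * decay_weight x"
proof -
  have split: "decay_weight z = inverse (1 + (z \<bullet> b)\<^sup>2) * (\<Prod>c\<in>Basis - {b}. inverse (1 + (z \<bullet> c)\<^sup>2))" for z :: 'a
    unfolding decay_weight_def using assms by (subst prod.remove) auto
  have "(x + s *\<^sub>R b) \<bullet> c = x \<bullet> c" if "c \<in> Basis - {b}" for c
    using that assms by (auto simp: inner_add_left inner_not_same_Basis)
  moreover have "inverse (1 + ((x + s *\<^sub>R b) \<bullet> b)\<^sup>2) \<le> 3 * inverse (1 + (x \<bullet> b)\<^sup>2)"
  proof -
    define z where "z = (x + s *\<^sub>R b) \<bullet> b"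
    have "x \<bullet> b = z - s" using assms by (simp add: z_def inner_add_left)
    moreover have "(z - s)\<^sup>2 \<le> 2 * z\<^sup>2 + 2 * s\<^sup>2"
      using zero_le_power2[of "z + s"] by (simp add: power2_eq_square algebra_simps)
    moreover have "s\<^sup>2 \<le> 1" using assms by (simp add: power_le_one)
    ultimately have "1 + (x \<bullet> b)\<^sup>2 \<le> 3 * (1 + z\<^sup>2)"
      using zero_le_power2[of z] by (simp only: distrib_left)
    then show ?thesis
      unfolding z_def[symmetric] by (simp add: field_simps add_pos_nonneg)
  qed
  ultimately show ?thesis
    unfolding split by (simp add: mult.assoc[symmetric] mult_right_mono prod_nonneg)
qed

lemma decay_weight_lower:
  "1 \<le> 2 ^ DIM('a) * (1 + norm x ^ (2 * DIM('a))) * decay_weight (x :: 'a::euclidean_space)"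
proof -
  let ?n = "DIM('a)" and ?P = "\<Prod>b\<in>Basis. (1 + (x \<bullet> b)\<^sup>2)"
  have "?P \<le> (\<Prod>b\<in>(Basis::'a set). (1 + (norm x)\<^sup>2))"
    by (intro prod_mono conjI add_left_mono) (auto simp: abs_le_square_iff[symmetric] Basis_le_norm)
  also have "\<dots> = (1 + (norm x)\<^sup>2) ^ ?n" by simp
  also have "\<dots> \<le> (2 * max 1 ((norm x)\<^sup>2)) ^ ?n"
    by (intro power_mono) auto
  also have "\<dots> = 2 ^ ?n * (max 1 ((norm x)\<^sup>2)) ^ ?n" by (simp add: power_mult_distrib)
  also have "\<dots> \<le> 2 ^ ?n * (1 + norm x ^ (2 * ?n))"
    by (intro mult_left_mono) (auto simp: max_def power_mult)
  finally have "?P \<le> 2 ^ ?n * (1 + norm x ^ (2 * ?n))" .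
  moreover have "?P * decay_weight x = 1"
    unfolding decay_weight_def prod.distrib[symmetric]
    by (intro prod.neutral ballI right_inverse) (simp add: add_nonneg_eq_0_iff)
  ultimately show ?thesis
    by (metis decay_weight_pos less_imp_le mult_right_mono)
qed

text \<open>Expanding \<open>(1 + norm x ^ m) * (1 + norm x ^ (2 * DIM('a)))\<close> leaves four of the decay estimates. Each
is at most the sum of all of them, which avoids distinguishing which of the four exponents coincide.\<close>

lemma rapid_decay_le_weight:
  fixes x :: "'a::euclidean_space"
  assumes S: "\<And>k. k \<le> m + 2 * DIM('a) \<Longrightarrow> norm x ^ k * c \<le> S k" and "0 \<le> c"
  shows "(1 + norm x ^ m) * c \<le> 4 * 2 ^ DIM('a) * (\<Sum>k\<le>m + 2 * DIM('a). S k) * decay_weight x"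
proof -
  let ?n = "DIM('a)" and ?\<Sigma> = "\<Sum>k\<le>m + 2 * DIM('a). S k"
  have "norm x ^ k * c \<le> ?\<Sigma>" if "k \<le> m + 2 * ?n" for k
  proof -
    have "0 \<le> S j" if "j \<le> m + 2 * ?n" for j
      using S[OF that] \<open>0 \<le> c\<close> by (meson mult_nonneg_nonneg norm_ge_zero order_trans zero_le_power)
    then have "S k \<le> ?\<Sigma>" using that by (intro member_le_sum) auto
    then show ?thesis using S[OF that] by simp
  qed
  from this[of 0] this[of m] this[of "2 * ?n"] this[of "m + 2 * ?n"]
  have "(1 + norm x ^ m) * (1 + norm x ^ (2 * ?n)) * c \<le> 4 * ?\<Sigma>"
    by (simp add: algebra_simps power_add)
  then have "2 ^ ?n * decay_weight x * ((1 + norm x ^ m) * (1 + norm x ^ (2 * ?n)) * c)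
      \<le> 2 ^ ?n * decay_weight x * (4 * ?\<Sigma>)"
    by (intro mult_left_mono) (auto simp: decay_weight_pos less_imp_le)
  moreover have "(1 + norm x ^ m) * c * 1
      \<le> (1 + norm x ^ m) * c * (2 ^ ?n * (1 + norm x ^ (2 * ?n)) * decay_weight x)"
    using \<open>0 \<le> c\<close> by (intro mult_left_mono decay_weight_lower) auto
  ultimately show ?thesis by (simp add: mult_ac)
qed

text \<open>The quantitative estimate behind every continuity statement below: it is used with \<open>\<psi>\<close> a
Schwartz function and with \<open>\<psi>\<close> the Fourier transform of one.\<close>
lemma
  fixes f \<psi> :: "'a::euclidean_space \<Rightarrow> complex"
  assumes [measurable]: "f \<in> borel_measurable borel" "\<psi> \<in> borel_measurable borel"
    and f: "\<And>x. norm (f x) \<le> C * (1 + norm x ^ m)"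
    and S: "\<And>k x. k \<le> m + 2 * DIM('a) \<Longrightarrow> norm x ^ k * norm (\<psi> x) \<le> S k"
  shows integrable_growth_times_decay: "integrable lborel (\<lambda>x. f x * \<psi> x)"
    and integral_growth_times_decay: "(LINT x|lborel. norm (f x * \<psi> x))
      \<le> 4 * 2 ^ DIM('a) * integral\<^sup>L lborel (decay_weight :: 'a \<Rightarrow> real) * C * (\<Sum>k\<le>m + 2 * DIM('a). S k)"
proof -
  let ?A = "4 * 2 ^ DIM('a) * C * (\<Sum>k\<le>m + 2 * DIM('a). S k)"
  have C: "0 \<le> C"
    using order_trans[OF norm_ge_zero f[of 0]] by (cases m) (auto simp: zero_le_mult_iff)
  have le: "norm (f x * \<psi> x) \<le> ?A * decay_weight x" for x
  proof -
    have "norm (f x * \<psi> x) \<le> C * (1 + norm x ^ m) * norm (\<psi> x)"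
      unfolding norm_mult by (intro mult_right_mono f) auto
    also have "\<dots> = C * ((1 + norm x ^ m) * norm (\<psi> x))" by simp
    also have "\<dots> \<le> C * (4 * 2 ^ DIM('a) * (\<Sum>k\<le>m + 2 * DIM('a). S k) * decay_weight x)"
      by (intro mult_left_mono C rapid_decay_le_weight S) auto
    finally show ?thesis by (simp add: mult_ac)
  qed
  have int: "integrable lborel (\<lambda>x::'a. ?A * decay_weight x)"
    by (intro integrable_mult_right integrable_decay_weight)
  show *: "integrable lborel (\<lambda>x. f x * \<psi> x)"
  proof (rule Bochner_Integration.integrable_bound[OF int])
    show "AE x in lborel. norm (f x * \<psi> x) \<le> norm (?A * decay_weight x)"
      using le by (intro AE_I2) (metis abs_ge_self order_trans real_norm_def)
  qed simp
  have "(LINT x|lborel. norm (f x * \<psi> x)) \<le> (LINT x|lborel. ?A * decay_weight (x::'a))"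
    using * int le by (intro integral_mono) auto
  then show "(LINT x|lborel. norm (f x * \<psi> x))
      \<le> 4 * 2 ^ DIM('a) * integral\<^sup>L lborel (decay_weight :: 'a \<Rightarrow> real) * C * (\<Sum>k\<le>m + 2 * DIM('a). S k)"
    by (simp add: mult_ac)
qed

lemma
  fixes \<phi> :: "'a::euclidean_space \<Rightarrow> complex"
  assumes "\<phi> \<in> schwartz_space"
  shows schwartz_integrable: "integrable lborel \<phi>"
    and schwartz_L1_le: "(LINT x|lborel. norm (\<phi> x))
      \<le> 4 * 2 ^ DIM('a) * integral\<^sup>L lborel (decay_weight :: 'a \<Rightarrow> real) * (\<Sum>k\<le>2 * DIM('a). schwartz_seminorm k [] \<phi>)"
proof -
  have [measurable]: "\<phi> \<in> borel_measurable borel" using assms by measurable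
  note * = schwartz_seminorm_upper[OF assms, of "[]", simplified]
  show "integrable lborel \<phi>"
    using integrable_growth_times_decay[of "\<lambda>_. 1" \<phi> 1 0, OF _ _ _ *] by simp
  show "(LINT x|lborel. norm (\<phi> x))
      \<le> 4 * 2 ^ DIM('a) * integral\<^sup>L lborel (decay_weight :: 'a \<Rightarrow> real) * (\<Sum>k\<le>2 * DIM('a). schwartz_seminorm k [] \<phi>)"
    using integral_growth_times_decay[of "\<lambda>_. 1" \<phi> 1 0, OF _ _ _ *] by simp
qed

lemma schwartz_le_weight:
  fixes \<phi> :: "'a::euclidean_space \<Rightarrow> complex"
  assumes "\<phi> \<in> schwartz_space"
  obtains K where "\<And>x. norm (\<phi> x) \<le> K * decay_weight x"
proof
  fix x
  have "2 * norm (\<phi> x) \<le> 4 * 2 ^ DIM('a) * (\<Sum>k\<le>0 + 2 * DIM('a). schwartz_seminorm k [] \<phi>) * decay_weight x"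
    using rapid_decay_le_weight[of 0 x "norm (\<phi> x)" "\<lambda>k. schwartz_seminorm k [] \<phi>"]
      schwartz_seminorm_upper[OF assms, of "[]"] by simp
  then show "norm (\<phi> x) \<le> (2 * 2 ^ DIM('a) * (\<Sum>k\<le>2 * DIM('a). schwartz_seminorm k [] \<phi>)) * decay_weight x"
    by (simp add: mult_ac)
qed

section \<open>Fourier transforms of Schwartz functions and of functions of polynomial growth\<close>

lemma norm_exp_i_real: "norm (exp (- \<i> * complex_of_real t)) = 1"
  using norm_exp_i_times[of "- t"] by simp

lemma borel_measurable_fourier:
  fixes \<phi> :: "'a::euclidean_space \<Rightarrow> complex"
  assumes [measurable]: "\<phi> \<in> borel_measurable borel"
  shows "fourier \<phi> \<in> borel_measurable borel"
  unfolding fourier_def by measurable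

lemma integrable_fourier_kernel:
  fixes \<phi> :: "'a::euclidean_space \<Rightarrow> complex"
  assumes "integrable lborel \<phi>"
  shows "integrable lborel (\<lambda>x. \<phi> x * exp (- \<i> * complex_of_real (y \<bullet> x)))"
proof (rule Bochner_Integration.integrable_bound[OF assms])
  have [measurable]: "\<phi> \<in> borel_measurable borel" using assms by auto
  show "(\<lambda>x. \<phi> x * exp (- \<i> * complex_of_real (y \<bullet> x))) \<in> borel_measurable lborel" by simp
qed (simp only: norm_mult norm_exp_i_real, simp)

lemma fourier_lincomb:
  fixes \<phi> \<psi> :: "'a::euclidean_space \<Rightarrow> complex"
  assumes "integrable lborel \<phi>" "integrable lborel \<psi>"
  shows "fourier (\<lambda>x. a * \<phi> x + b * \<psi> x) = (\<lambda>y. a * fourier \<phi> y + b * fourier \<psi> y)"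
proof
  fix y
  have "fourier (\<lambda>x. a * \<phi> x + b * \<psi> x) y
    = (LINT x|lborel. a * (\<phi> x * exp (- \<i> * complex_of_real (y \<bullet> x)))
        + b * (\<psi> x * exp (- \<i> * complex_of_real (y \<bullet> x))))"
    unfolding fourier_def by (intro Bochner_Integration.integral_cong) (auto simp: algebra_simps)
  also have "\<dots> = a * fourier \<phi> y + b * fourier \<psi> y"
    unfolding fourier_def
    by (subst Bochner_Integration.integral_add)
       (intro integrable_mult_right integrable_fourier_kernel assms integral_mult_right_zero refl | simp)+
  finally show "fourier (\<lambda>x. a * \<phi> x + b * \<psi> x) y = a * fourier \<phi> y + b * fourier \<psi> y" .
qed

lemma norm_fourier_le: "norm (fourier \<phi> y) \<le> (LINT x|lborel. norm (\<phi> x))"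
proof -
  have "norm (fourier \<phi> y) \<le> (LINT x|lborel. norm (\<phi> x * exp (- \<i> * complex_of_real (y \<bullet> x))))"
    unfolding fourier_def by (rule integral_norm_bound)
  then show ?thesis unfolding norm_mult norm_exp_i_real by simp
qed

lemma fourier_translate:
  fixes \<phi> :: "'a::euclidean_space \<Rightarrow> complex"
  assumes [measurable]: "\<phi> \<in> borel_measurable borel"
  shows "fourier (\<lambda>x. \<phi> (x + a)) y = exp (\<i> * complex_of_real (y \<bullet> a)) * fourier \<phi> y"
proof -
  have "fourier \<phi> y = (LINT x|distr lborel borel ((+) a). \<phi> x * exp (- \<i> * complex_of_real (y \<bullet> x)))"
    unfolding fourier_def lborel_distr_plus ..
  also have "\<dots> = (LINT x|lborel. \<phi> (a + x) * exp (- \<i> * complex_of_real (y \<bullet> (a + x))))"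
    by (subst integral_distr) auto
  also have "\<dots> = (LINT x|lborel. exp (- \<i> * complex_of_real (y \<bullet> a)) *
      (\<phi> (x + a) * exp (- \<i> * complex_of_real (y \<bullet> x))))"
    by (intro Bochner_Integration.integral_cong)
       (simp_all add: inner_add_right algebra_simps exp_add[symmetric])
  also have "\<dots> = exp (- \<i> * complex_of_real (y \<bullet> a)) * fourier (\<lambda>x. \<phi> (x + a)) y"
    unfolding fourier_def by simp
  finally show ?thesis by (simp add: exp_minus)
qed

text \<open>Instead of integrating by parts, the translation rule is differentiated at zero. The Fourier transform
of the difference quotient \<open>(\<phi> (x + t b) - \<phi> x) / t\<close> is \<open>(exp (\<i> t (y \<bullet> b)) - 1) / t\<close> times that of
\<open>\<phi>\<close>. As \<open>t\<close> tends to zero, dominated convergence gives the derivative on the one side and the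
factor \<open>\<i> (y \<bullet> b)\<close> on the other.\<close>

lemma fourier_partial_deriv:
  fixes \<phi> :: "'a::euclidean_space \<Rightarrow> complex"
  assumes \<phi>: "\<phi> \<in> schwartz_space" and b: "b \<in> Basis"
  shows "fourier (partial_derivs [b] \<phi>) y = \<i> * complex_of_real (y \<bullet> b) * fourier \<phi> y"
proof -
  define t where "t i = inverse (real (Suc i))" for i
  have t: "0 < t i" "t i \<le> 1" for i by (auto simp: t_def field_simps)
  have t0: "t \<longlonglongrightarrow> 0" unfolding t_def by (rule LIMSEQ_inverse_real_of_nat)
  define e where "e x = exp (- \<i> * complex_of_real (y \<bullet> x))" for x
  define q where "q i x = (\<phi> (x + t i *\<^sub>R b) - \<phi> x) / complex_of_real (t i)" for i x
  let ?D = "\<lambda>x. frechet_derivative \<phi> (at x)"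
  have [measurable]: "\<phi> \<in> borel_measurable borel" using \<phi> by measurable
  have D: "(\<phi> has_derivative ?D x) (at x)" for x
    using smooth_has_derivative[of \<phi> "[]"] \<phi> by (auto simp: schwartz_space_def)
  have "partial_derivs [b] \<phi> \<in> schwartz_space"
    using schwartz_partial_derivs[OF \<phi>, of "[b]"] b by simp
  then have Db: "(\<lambda>x. ?D x b) \<in> schwartz_space" by simp
  then have [measurable]: "(\<lambda>x. ?D x b) \<in> borel_measurable borel" by (rule schwartz_measurable)
  obtain K where K: "\<And>x. norm (?D x b) \<le> K * decay_weight x"
    using schwartz_le_weight[OF Db] by blast
  have "0 \<le> K"
    using order_trans[OF norm_ge_zero K[of 0]] decay_weight_pos[of "0::'a"] by (simp add: zero_le_mult_iff)

  \<comment> \<open>The mean value inequality on the segment from \<open>x\<close> to \<open>x + t i b\<close> supplies the majorant.\<close>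
  have bound: "norm (q i x) \<le> K * (3 * decay_weight x)" for i x
  proof -
    have der: "((\<lambda>s. \<phi> (x + s *\<^sub>R b)) has_derivative (\<lambda>h. ?D (x + s *\<^sub>R b) (h *\<^sub>R b))) (at s)" for s
      by (rule has_derivative_compose[of "\<lambda>s. x + s *\<^sub>R b" "\<lambda>h. h *\<^sub>R b", OF _ D])
         (auto intro!: derivative_eq_intros)
    then have "continuous_on {0..t i} (\<lambda>s. \<phi> (x + s *\<^sub>R b))"
      by (intro continuous_at_imp_continuous_on ballI has_derivative_continuous)
    from mvt_general[OF t(1) this der] obtain s where s: "0 < s" "s < t i"
      and le: "norm (\<phi> (x + t i *\<^sub>R b) - \<phi> x) \<le> norm (?D (x + s *\<^sub>R b) (t i *\<^sub>R b))"
      by auto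
    have "norm (?D (x + s *\<^sub>R b) (t i *\<^sub>R b)) = t i * norm (?D (x + s *\<^sub>R b) b)"
      using t[of i] by (simp add: linear_scale[OF has_derivative_linear[OF D]])
    with le have "norm (q i x) \<le> norm (?D (x + s *\<^sub>R b) b)"
      using t[of i] by (simp add: q_def norm_divide field_simps)
    also have "\<dots> \<le> K * decay_weight (x + s *\<^sub>R b)" by (rule K)
    also have "\<dots> \<le> K * (3 * decay_weight x)"
      using s t[of i] by (intro mult_left_mono decay_weight_shift b \<open>0 \<le> K\<close>) auto
    finally show ?thesis .
  qed

  have lim: "(\<lambda>i. q i x) \<longlonglongrightarrow> ?D x b" for x
  proof -
    have "((\<lambda>h. norm (\<phi> (x + h) - \<phi> x - ?D x h) / norm h) \<longlongrightarrow> 0) (at 0)"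
      using D[of x] by (simp add: has_derivative_at)
    moreover have "filterlim (\<lambda>i. t i *\<^sub>R b) (at 0) sequentially"
      using tendsto_scaleR[OF t0 tendsto_const[of b]] t(1) b
      by (auto simp: filterlim_at less_imp_neq[symmetric] nonzero_Basis)
    ultimately have "(\<lambda>i. norm (\<phi> (x + t i *\<^sub>R b) - \<phi> x - ?D x (t i *\<^sub>R b)) / norm (t i *\<^sub>R b)) \<longlonglongrightarrow> 0"
      by (rule filterlim_compose)
    also have "(\<lambda>i. norm (\<phi> (x + t i *\<^sub>R b) - \<phi> x - ?D x (t i *\<^sub>R b)) / norm (t i *\<^sub>R b))
        = (\<lambda>i. norm (q i x - ?D x b))"
    proof
      fix i
      have "q i x - ?D x b = (\<phi> (x + t i *\<^sub>R b) - \<phi> x - ?D x (t i *\<^sub>R b)) / complex_of_real (t i)"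
        using t(1)[of i] by (simp add: q_def linear_scale[OF has_derivative_linear[OF D]]
            diff_divide_distrib scaleR_conv_of_real)
      then show "norm (\<phi> (x + t i *\<^sub>R b) - \<phi> x - ?D x (t i *\<^sub>R b)) / norm (t i *\<^sub>R b) = norm (q i x - ?D x b)"
        using t(1)[of i] b by (simp add: norm_divide)
    qed
    finally show ?thesis by (rule LIM_zero_cancel[OF tendsto_norm_zero_cancel])
  qed

  have "(\<lambda>i. LINT x|lborel. q i x * e x) \<longlonglongrightarrow> (LINT x|lborel. ?D x b * e x)"
  proof (rule integral_dominated_convergence)
    show "integrable lborel (\<lambda>x::'a. K * (3 * decay_weight x))"
      by (intro integrable_mult_right integrable_decay_weight)
    show "AE x in lborel. (\<lambda>i. q i x * e x) \<longlonglongrightarrow> ?D x b * e x"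
      by (intro AE_I2 tendsto_mult lim tendsto_const)
    show "AE x in lborel. norm (q i x * e x) \<le> K * (3 * decay_weight x)" for i
      unfolding norm_mult e_def norm_exp_i_real using bound by simp
  qed (unfold q_def e_def, measurable)
  also have "(\<lambda>i. LINT x|lborel. q i x * e x)
      = (\<lambda>i. (exp (complex_of_real (t i) * (\<i> * complex_of_real (y \<bullet> b))) - 1) / complex_of_real (t i) * fourier \<phi> y)"
  proof
    fix i
    have "integrable lborel \<phi>" by (rule schwartz_integrable[OF \<phi>])
    moreover have "integrable lborel (\<lambda>x. \<phi> (x + t i *\<^sub>R b))"
      using calculation by (subst (asm) lborel_distr_plus[symmetric, of "t i *\<^sub>R b"])
        (simp add: integrable_distr_eq add.commute)
    ultimately have "fourier (\<lambda>x. inverse (complex_of_real (t i)) * \<phi> (x + t i *\<^sub>R b) + (- inverse (complex_of_real (t i))) * \<phi> x) y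
      = inverse (complex_of_real (t i)) * (exp (\<i> * complex_of_real (y \<bullet> (t i *\<^sub>R b))) * fourier \<phi> y)
        + (- inverse (complex_of_real (t i))) * fourier \<phi> y"
      by (simp only: fourier_lincomb fourier_translate \<open>\<phi> \<in> borel_measurable borel\<close>)
    moreover have "(LINT x|lborel. q i x * e x)
      = fourier (\<lambda>x. inverse (complex_of_real (t i)) * \<phi> (x + t i *\<^sub>R b) + (- inverse (complex_of_real (t i))) * \<phi> x) y"
      unfolding fourier_def q_def e_def
      by (intro Bochner_Integration.integral_cong) (simp_all add: divide_inverse algebra_simps)
    ultimately show "(LINT x|lborel. q i x * e x)
      = (exp (complex_of_real (t i) * (\<i> * complex_of_real (y \<bullet> b))) - 1) / complex_of_real (t i) * fourier \<phi> y"
      by (simp add: divide_inverse algebra_simps)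
  qed
  finally have 1: "(\<lambda>i. (exp (complex_of_real (t i) * (\<i> * complex_of_real (y \<bullet> b))) - 1) / complex_of_real (t i) * fourier \<phi> y)
      \<longlonglongrightarrow> fourier (partial_derivs [b] \<phi>) y"
    by (simp add: fourier_def e_def)
  have "((\<lambda>z. exp (z * (\<i> * complex_of_real (y \<bullet> b)))) has_field_derivative \<i> * complex_of_real (y \<bullet> b)) (at 0)"
    by (auto intro!: derivative_eq_intros)
  then have "((\<lambda>z. (exp (z * (\<i> * complex_of_real (y \<bullet> b))) - 1) / z) \<longlongrightarrow> \<i> * complex_of_real (y \<bullet> b)) (at 0)"
    by (simp add: DERIV_def)
  moreover have "filterlim (\<lambda>i. complex_of_real (t i)) (at 0) sequentially"
    using tendsto_of_real[OF t0, where ?'a = complex] t(1)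
    by (auto simp: filterlim_at less_imp_neq[symmetric])
  ultimately have 2: "(\<lambda>i. (exp (complex_of_real (t i) * (\<i> * complex_of_real (y \<bullet> b))) - 1) / complex_of_real (t i))
      \<longlonglongrightarrow> \<i> * complex_of_real (y \<bullet> b)"
    by (rule filterlim_compose)
  show ?thesis
    by (rule LIMSEQ_unique[OF 1 tendsto_mult[OF 2 tendsto_const]])
qed

lemma fourier_iterated_partial_deriv:
  fixes \<phi> :: "'a::euclidean_space \<Rightarrow> complex"
  assumes "\<phi> \<in> schwartz_space" "b \<in> Basis"
  shows "fourier (partial_derivs (replicate k b) \<phi>) y = (\<i> * complex_of_real (y \<bullet> b)) ^ k * fourier \<phi> y"
proof (induction k)
  case (Suc k)
  have "partial_derivs (replicate k b) \<phi> \<in> schwartz_space"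
    using assms by (intro schwartz_partial_derivs) auto
  from fourier_partial_deriv[OF this assms(2), of y] Suc show ?case by simp
qed simp

text \<open>The largest coordinate \<open>y \<bullet> c\<close> satisfies \<open>norm y \<le> DIM('a) * \<bar>y \<bullet> c\<bar>\<close>, and multiplying the Fourier
transform by \<open>(y \<bullet> c) ^ k\<close> amounts to differentiating \<open>\<phi>\<close> \<open>k\<close> times in direction \<open>c\<close>. Hence all
polynomial moments of the transform are controlled by seminorms of \<open>\<phi>\<close>.\<close>

lemma fourier_decay:
  fixes \<phi> :: "'a::euclidean_space \<Rightarrow> complex"
  assumes \<phi>: "\<phi> \<in> schwartz_space"
  shows "norm y ^ k * norm (fourier \<phi> y) \<le> real DIM('a) ^ k * (4 * 2 ^ DIM('a) * integral\<^sup>L lborel (decay_weight :: 'a \<Rightarrow> real)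
    * (\<Sum>b\<in>Basis. \<Sum>l\<le>2 * DIM('a). schwartz_seminorm l (replicate k b) \<phi>))"
proof -
  let ?A = "4 * 2 ^ DIM('a) * integral\<^sup>L lborel (decay_weight :: 'a \<Rightarrow> real)"
  have coord: "\<bar>y \<bullet> b\<bar> ^ k * norm (fourier \<phi> y) \<le> ?A * (\<Sum>l\<le>2 * DIM('a). schwartz_seminorm l (replicate k b) \<phi>)"
    if b: "b \<in> Basis" for b
  proof -
    let ?\<psi> = "partial_derivs (replicate k b) \<phi>"
    have \<psi>: "?\<psi> \<in> schwartz_space" using b by (intro schwartz_partial_derivs \<phi>) auto
    have "\<bar>y \<bullet> b\<bar> ^ k * norm (fourier \<phi> y) = norm (fourier ?\<psi> y)"
      unfolding fourier_iterated_partial_deriv[OF \<phi> b] by (simp add: norm_mult norm_power)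
    also have "\<dots> \<le> (LINT x|lborel. norm (?\<psi> x))" by (rule norm_fourier_le)
    also have "\<dots> \<le> ?A * (\<Sum>l\<le>2 * DIM('a). schwartz_seminorm l [] ?\<psi>)" by (rule schwartz_L1_le[OF \<psi>])
    finally show ?thesis by (simp add: schwartz_seminorm_def)
  qed
  obtain c where c: "c \<in> Basis" "\<And>b. b \<in> Basis \<Longrightarrow> \<bar>y \<bullet> b\<bar> \<le> \<bar>y \<bullet> c\<bar>"
  proof -
    have "Max ((\<lambda>b. \<bar>y \<bullet> b\<bar>) ` Basis) \<in> (\<lambda>b. \<bar>y \<bullet> b\<bar>) ` Basis" by (intro Max_in) auto
    then obtain c where "c \<in> Basis" "Max ((\<lambda>b. \<bar>y \<bullet> b\<bar>) ` Basis) = \<bar>y \<bullet> c\<bar>" by (rule imageE)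
    with Max_ge[of "(\<lambda>b. \<bar>y \<bullet> b\<bar>) ` Basis"] that show ?thesis by auto
  qed
  have "norm y \<le> (\<Sum>b\<in>Basis. \<bar>y \<bullet> b\<bar>)" by (rule norm_le_l1)
  also have "\<dots> \<le> real DIM('a) * \<bar>y \<bullet> c\<bar>" using c by (intro sum_bounded_above) auto
  finally have "norm y ^ k \<le> (real DIM('a) * \<bar>y \<bullet> c\<bar>) ^ k" by (intro power_mono) auto
  then have "norm y ^ k * norm (fourier \<phi> y) \<le> (real DIM('a) * \<bar>y \<bullet> c\<bar>) ^ k * norm (fourier \<phi> y)"
    by (rule mult_right_mono) simp
  also have "\<dots> = real DIM('a) ^ k * (\<bar>y \<bullet> c\<bar> ^ k * norm (fourier \<phi> y))"
    by (simp add: power_mult_distrib)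
  also have "\<dots> \<le> real DIM('a) ^ k * (?A * (\<Sum>l\<le>2 * DIM('a). schwartz_seminorm l (replicate k c) \<phi>))"
    by (intro mult_left_mono coord c) auto
  also have "\<dots> \<le> real DIM('a) ^ k * (?A * (\<Sum>b\<in>Basis. \<Sum>l\<le>2 * DIM('a). schwartz_seminorm l (replicate k b) \<phi>))"
    using c integral_decay_weight_nonneg[where ?'a='a]
    by (intro mult_left_mono member_le_sum sum_nonneg schwartz_seminorm_nonneg \<phi>) auto
  finally show ?thesis .
qed

lemma fourier_schwartz_measurable:
  "\<phi> \<in> schwartz_space \<Longrightarrow> fourier \<phi> \<in> borel_measurable borel"
  by (intro borel_measurable_fourier schwartz_measurable)

lemma integrable_growth_times_fourier:
  fixes f \<phi> :: "'a::euclidean_space \<Rightarrow> complex"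
  assumes "f \<in> borel_measurable borel" "\<And>x. norm (f x) \<le> C * (1 + norm x ^ m)" "\<phi> \<in> schwartz_space"
  shows "integrable lborel (\<lambda>x. f x * fourier \<phi> x)"
  by (rule integrable_growth_times_decay[OF assms(1) fourier_schwartz_measurable[OF assms(3)] assms(2)
        fourier_decay[OF assms(3)]])

text \<open>Pairing with a Schwartz function, or with its Fourier transform, is bounded by finitely many seminorms,
because both decay faster than the growth of \<open>f\<close> and the decay is itself measured by seminorms.\<close>

lemma polynomial_growth_has_generalised_fourier:
  fixes f :: "'a::euclidean_space \<Rightarrow> complex"
  assumes f [measurable]: "f \<in> borel_measurable borel" and growth: "\<And>x. norm (f x) \<le> C * (1 + norm x ^ m)"
  shows "has_generalised_fourier f"
proof -
  let ?n = "DIM('a)" and ?A = "4 * 2 ^ DIM('a) * integral\<^sup>L lborel (decay_weight :: 'a \<Rightarrow> real)"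
  have C: "0 \<le> C"
    using order_trans[OF norm_ge_zero growth[of 0]] by (cases m) (auto simp: zero_le_mult_iff)
  have A: "0 \<le> ?A" using integral_decay_weight_nonneg[where ?'a='a] by simp
  have int: "integrable lborel (\<lambda>x. f x * \<phi> x)" if "\<phi> \<in> schwartz_space" for \<phi>
    using integrable_growth_times_decay[OF f schwartz_measurable[OF that] growth
        schwartz_seminorm_upper[OF that, of "[]", simplified]] by simp
  have "tempered_distribution (regular_distribution f)"
  proof (rule tempered_distributionI[where I = "{..m + 2 * ?n}" and C = "?A * C" and k = "\<lambda>k. k" and vs = "\<lambda>_. []"])
    fix \<phi> :: "'a \<Rightarrow> complex" assume \<phi>: "\<phi> \<in> schwartz_space"
    have "norm (regular_distribution f \<phi>) \<le> (LINT x|lborel. norm (f x * \<phi> x))"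
      unfolding regular_distribution_def by (rule integral_norm_bound)
    also have "\<dots> \<le> ?A * C * (\<Sum>k\<le>m + 2 * ?n. schwartz_seminorm k [] \<phi>)"
      using integral_growth_times_decay[OF f schwartz_measurable[OF \<phi>] growth
        schwartz_seminorm_upper[OF \<phi>, of "[]", simplified]] by simp
    finally show "norm (regular_distribution f \<phi>) \<le> ?A * C * (\<Sum>k\<le>m + 2 * ?n. schwartz_seminorm k [] \<phi>)" .
    fix c
    show "regular_distribution f (\<lambda>x. c * \<phi> x) = c * regular_distribution f \<phi>"
      by (simp add: regular_distribution_def mult.left_commute)
    fix \<psi> :: "'a \<Rightarrow> complex" assume "\<psi> \<in> schwartz_space"
    then show "regular_distribution f (\<lambda>x. \<phi> x + \<psi> x) = regular_distribution f \<phi> + regular_distribution f \<psi>"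
      using int \<phi> by (simp add: regular_distribution_def distrib_left)
  qed auto
  moreover have "tempered_distribution (generalised_fourier f)"
  proof (rule tempered_distributionI[where I = "{..m + 2 * ?n} \<times> (Basis \<times> {..2 * ?n})"
        and C = "?A * C * (real ?n ^ (m + 2 * ?n) * ?A)"
        and k = "\<lambda>(k, b, l). l" and vs = "\<lambda>(k, b, l). replicate k b"])
    fix \<phi> :: "'a \<Rightarrow> complex" assume \<phi>: "\<phi> \<in> schwartz_space"
    let ?s = "\<lambda>k. \<Sum>b\<in>Basis. \<Sum>l\<le>2 * ?n. schwartz_seminorm l (replicate k b) \<phi>"
    have s: "0 \<le> ?s k" for k
      by (intro sum_nonneg schwartz_seminorm_nonneg \<phi>) auto
    have "norm (generalised_fourier f \<phi>) \<le> (LINT x|lborel. norm (f x * fourier \<phi> x))"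
      unfolding generalised_fourier_def fourier_distribution_def regular_distribution_def
      by (rule integral_norm_bound)
    also have "\<dots> \<le> ?A * C * (\<Sum>k\<le>m + 2 * ?n. real ?n ^ k * (?A * ?s k))"
      by (rule integral_growth_times_decay[OF f fourier_schwartz_measurable[OF \<phi>] growth fourier_decay[OF \<phi>]])
    also have "\<dots> \<le> ?A * C * (\<Sum>k\<le>m + 2 * ?n. real ?n ^ (m + 2 * ?n) * (?A * ?s k))"
      using A C s DIM_positive[where ?'a='a] integral_decay_weight_nonneg[where ?'a='a]
      by (intro mult_left_mono sum_mono mult_right_mono power_increasing mult_nonneg_nonneg) auto
    also have "\<dots> = ?A * C * (real ?n ^ (m + 2 * ?n) * ?A) * (\<Sum>k\<le>m + 2 * ?n. ?s k)"
      by (simp add: sum_distrib_left mult_ac)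
    also have "(\<Sum>k\<le>m + 2 * ?n. ?s k) =
      (\<Sum>i\<in>{..m + 2 * ?n} \<times> (Basis \<times> {..2 * ?n}). schwartz_seminorm (case i of (k, b, l) \<Rightarrow> l) (case i of (k, b, l) \<Rightarrow> replicate k b) \<phi>)"
      by (simp add: sum.cartesian_product split_def)
    finally show "norm (generalised_fourier f \<phi>) \<le> ?A * C * (real ?n ^ (m + 2 * ?n) * ?A) *
      (\<Sum>i\<in>{..m + 2 * ?n} \<times> (Basis \<times> {..2 * ?n}). schwartz_seminorm (case i of (k, b, l) \<Rightarrow> l) (case i of (k, b, l) \<Rightarrow> replicate k b) \<phi>)" .
    note int\<phi> = schwartz_integrable[OF \<phi>] integrable_growth_times_fourier[OF f growth \<phi>]
    fix c
    show "generalised_fourier f (\<lambda>x. c * \<phi> x) = c * generalised_fourier f \<phi>"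
      using fourier_lincomb[OF int\<phi>(1) int\<phi>(1), of c 0]
      by (simp add: generalised_fourier_def fourier_distribution_def regular_distribution_def mult.left_commute)
    fix \<psi> :: "'a \<Rightarrow> complex" assume \<psi>: "\<psi> \<in> schwartz_space"
    show "generalised_fourier f (\<lambda>x. \<phi> x + \<psi> x) = generalised_fourier f \<phi> + generalised_fourier f \<psi>"
      using fourier_lincomb[OF int\<phi>(1) schwartz_integrable[OF \<psi>], of 1 1] int\<phi>(2)
        integrable_growth_times_fourier[OF f growth \<psi>]
      by (simp add: generalised_fourier_def fourier_distribution_def regular_distribution_def distrib_left)
  qed auto
  ultimately show ?thesis
    using int by (simp add: has_generalised_fourier_def tempered_function_def)
qed

lemma test_functions_subset_schwartz:
  fixes U :: "'a::euclidean_space set"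
  shows "test_functions U \<subseteq> schwartz_space"
proof
  fix \<phi> :: "'a \<Rightarrow> complex" assume "\<phi> \<in> test_functions U"
  define K where "K = closure {x. \<phi> x \<noteq> 0}"
  have sm: "smooth \<phi>" and K: "compact K"
    using \<open>\<phi> \<in> test_functions U\<close> by (auto simp: test_functions_def K_def)
  have zero: "partial_derivs vs \<phi> x = 0" if "set vs \<subseteq> Basis" "x \<notin> K" for vs x
    using that
  proof (induction vs arbitrary: x)
    case Nil
    then show ?case using closure_subset[of "{x. \<phi> x \<noteq> 0}"] by (auto simp: K_def)
  next
    case (Cons v vs)
    have "((\<lambda>_. 0) has_derivative (\<lambda>_. 0)) (at x)" by simp
    then have "(partial_derivs vs \<phi> has_derivative (\<lambda>_. 0)) (at x)"
    proof (rule has_derivative_transform_within_open)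
      show "open (- K)" using K by (simp add: compact_imp_closed open_Compl)
    qed (use Cons in auto)
    from fun_cong[OF frechet_derivative_at[OF this], of v] show ?case by simp
  qed
  have "bdd_above (range (\<lambda>x. norm x ^ k * norm (partial_derivs vs \<phi> x)))" if vs: "set vs \<subseteq> Basis" for k vs
  proof -
    have "continuous_on K (partial_derivs vs \<phi>)"
      using sm vs unfolding smooth_def
      by (intro continuous_at_imp_continuous_on ballI differentiable_imp_continuous_within) auto
    then have "compact ((\<lambda>x. norm x ^ k * norm (partial_derivs vs \<phi> x)) ` K)"
      by (intro compact_continuous_image continuous_intros K)
    then have "bdd_above ((\<lambda>x. norm x ^ k * norm (partial_derivs vs \<phi> x)) ` K)"
      by (intro bounded_imp_bdd_above compact_imp_bounded)
    then obtain B where B: "\<And>x. x \<in> K \<Longrightarrow> norm x ^ k * norm (partial_derivs vs \<phi> x) \<le> B"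
      unfolding bdd_above_def by blast
    show ?thesis
    proof (rule bdd_aboveI2)
      show "norm x ^ k * norm (partial_derivs vs \<phi> x) \<le> max B 0" for x
        using B[of x] zero[OF vs, of x] by (cases "x \<in> K") auto
    qed
  qed
  then show "\<phi> \<in> schwartz_space" using sm by (auto simp: schwartz_space_def)
qed

section \<open>Polar coordinates for homogeneous functions\<close>

lemma nn_integral_lborel_scale:
  fixes f :: "'a::euclidean_space \<Rightarrow> ennreal"
  assumes [measurable]: "f \<in> borel_measurable borel" and "0 < c"
  shows "(\<integral>\<^sup>+x. f x \<partial>lborel) = ennreal (c ^ DIM('a)) * (\<integral>\<^sup>+x. f (c *\<^sub>R x) \<partial>lborel)"
proof -
  have "(\<integral>\<^sup>+x. f x \<partial>lborel) = (\<integral>\<^sup>+x. f x \<partial>density (distr lborel borel (\<lambda>x. 0 + c *\<^sub>R x)) (\<lambda>_. ennreal (\<bar>c\<bar> ^ DIM('a))))"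
    using assms by (subst lborel_affine[of c "0::'a"]) (auto simp: ennreal_power)
  also have "\<dots> = ennreal (c ^ DIM('a)) * (\<integral>\<^sup>+x. f (c *\<^sub>R x) \<partial>lborel)"
    using assms by (simp add: nn_integral_density nn_integral_distr nn_integral_cmult)
  finally show ?thesis .
qed

text \<open>By scaling, the measure with density \<open>P\<close> gives the ball of radius \<open>r\<close> the mass of the unit ball
times \<open>r ^ (DIM('a) + d)\<close>. The half-lines generate the Borel sets, so this determines the image of
the measure under the norm; differentiating in \<open>r\<close> gives its density.\<close>

lemma distr_norm_homogeneous:
  fixes P :: "'a::euclidean_space \<Rightarrow> real"
  assumes [measurable]: "P \<in> borel_measurable borel"
    and nonneg: "\<And>x. 0 \<le> P x"
    and hom: "\<And>c x. 0 < c \<Longrightarrow> P (c *\<^sub>R x) = c ^ d * P x"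
    and bound: "\<And>x. norm x \<le> 1 \<Longrightarrow> P x \<le> B"
  obtains \<kappa> where "0 \<le> \<kappa>"
    "distr (density lborel (\<lambda>x. ennreal (P x))) borel norm
      = density lborel (\<lambda>r. ennreal (\<kappa> * (indicator {0..} r * r ^ (DIM('a) + d - 1))))"
proof -
  let ?N = "DIM('a) + d"
  let ?M = "distr (density lborel (\<lambda>x. ennreal (P x))) borel norm"
  define F where "F r = (\<integral>\<^sup>+x. ennreal (P x) * indicator {..r} (norm x) \<partial>lborel)" for r
  have M: "emeasure ?M {..r} = F r" for r
    by (simp add: nn_integral_indicator[symmetric] nn_integral_distr nn_integral_density F_def
        del: nn_integral_indicator)
  have scale: "F r = ennreal (r ^ ?N) * F 1" if "0 < r" for r
  proof -
    have "F r = ennreal (r ^ DIM('a)) * (\<integral>\<^sup>+x. ennreal (P (r *\<^sub>R x)) * indicator {..r} (norm (r *\<^sub>R x)) \<partial>lborel)"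
      unfolding F_def by (rule nn_integral_lborel_scale[OF _ that]) measurable
    also have "(\<lambda>x. ennreal (P (r *\<^sub>R x)) * indicator {..r} (norm (r *\<^sub>R x)))
        = (\<lambda>x. ennreal (r ^ d) * (ennreal (P x) * indicator {..1} (norm x)))"
      using that nonneg by (intro ext) (auto simp: hom ennreal_mult indicator_def mult_ac)
    also have "(\<integral>\<^sup>+x. ennreal (r ^ d) * (ennreal (P x) * indicator {..1} (norm x)) \<partial>lborel) = ennreal (r ^ d) * F 1"
      unfolding F_def by (intro nn_integral_cmult) measurable
    finally show ?thesis using that by (simp add: power_add ennreal_mult mult_ac)
  qed
  have zero: "F 0 = 0"
  proof -
    have "F 0 = (\<integral>\<^sup>+x. ennreal (P x) * indicator {0} x \<partial>(lborel :: 'a measure))"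
      unfolding F_def by (intro nn_integral_cong) (auto simp: indicator_def)
    also have "\<dots> = 0"
      by (intro nn_integral_null_set) (simp add: null_sets_def)
    finally show ?thesis .
  qed
  have neg: "F r = 0" if "r < 0" for r
  proof -
    have "\<not> norm x \<le> r" for x :: 'a using that norm_ge_zero[of x] by linarith
    then show ?thesis unfolding F_def by simp
  qed
  have "F 1 \<le> (\<integral>\<^sup>+x. ennreal B * indicator (cball 0 1) x \<partial>(lborel :: 'a measure))"
    unfolding F_def by (intro nn_integral_mono) (auto simp: indicator_def intro!: ennreal_leI bound)
  also have "\<dots> = ennreal B * emeasure lborel (cball (0::'a) 1)"
    by (simp add: nn_integral_cmult_indicator)
  also have "\<dots> < \<infinity>"
    using emeasure_lborel_cball_finite[of "0::'a" 1] by (simp add: ennreal_mult_less_top)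
  finally have fin: "F 1 < \<infinity>" .
  define \<mu> where "\<mu> = enn2real (F 1)"
  have \<mu>: "F 1 = ennreal \<mu>" "0 \<le> \<mu>" using fin by (simp_all add: \<mu>_def)
  let ?D = "density lborel (\<lambda>r. ennreal ((\<mu> * real ?N) * (indicator {0..} r * r ^ (?N - 1))))"
  have D: "emeasure ?D {..r} = F r" for r
  proof (cases "0 \<le> r")
    case True
    have "emeasure ?D {..r} = (\<integral>\<^sup>+t. ennreal ((\<mu> * real ?N) * (indicator {0..} t * t ^ (?N - 1))) * indicator {..r} t \<partial>lborel)"
      by (subst emeasure_density) auto
    also have "\<dots> = (\<integral>\<^sup>+t. ennreal (\<mu> * (real ?N * t ^ (?N - 1))) * indicator {0..r} t \<partial>lborel)"
      by (intro nn_integral_cong) (auto simp: indicator_def mult_ac)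
    also have "\<dots> = \<mu> * r ^ ?N - \<mu> * 0 ^ ?N"
      using True \<mu>(2) by (intro nn_integral_FTC_Icc) (auto intro!: derivative_eq_intros)
    also have "\<dots> = ennreal (r ^ ?N) * F 1"
      using True \<mu> by (simp add: ennreal_mult mult.commute zero_power)
    also have "\<dots> = F r"
    proof (cases "r = 0")
      case True
      then show ?thesis using zero by (simp add: zero_power)
    next
      case False
      then show ?thesis using scale[of r] \<open>0 \<le> r\<close> by simp
    qed
    finally show ?thesis .
  next
    case False
    have "emeasure ?D {..r} = (\<integral>\<^sup>+t. ennreal ((\<mu> * real ?N) * (indicator {0..} t * t ^ (?N - 1))) * indicator {..r} t \<partial>lborel)"
      by (subst emeasure_density) auto
    also have "\<dots> = (\<integral>\<^sup>+(t::real). 0 \<partial>lborel)"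
      using False by (intro nn_integral_cong) (auto simp: indicator_def)
    finally show ?thesis using neg[of r] False by simp
  qed
  have "?M = ?D"
  proof (rule measure_eqI_generator_eq[where E = "range atMost" and \<Omega> = UNIV and A = "\<lambda>i. {..real i}"])
    show "Int_stable (range atMost :: real set set)"
      by (auto simp: Int_stable_def)
    show "emeasure ?M X = emeasure ?D X" if "X \<in> range atMost" for X
      using that M D by auto
    have gen: "sets borel = sigma_sets UNIV (range atMost :: real set set)"
      by (subst borel_eq_atMost) simp
    show "sets ?M = sigma_sets UNIV (range atMost)" "sets ?D = sigma_sets UNIV (range atMost)"
      by (simp_all add: gen[symmetric])
    show "(\<Union>i. {..real i}) = UNIV" by (auto intro: real_arch_simple)
    show "emeasure ?M {..real i} \<noteq> \<infinity>" for i
      unfolding M using zero scale[of "real i"] \<mu> by (cases i) (auto simp: ennreal_mult_eq_top_iff)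
  qed auto
  then show ?thesis using that[of "\<mu> * real ?N"] \<mu>(2) by simp
qed

text \<open>The characteristic function of a product Gaussian in direction \<open>\<theta>\<close> is the product of
\<open>exp (- (t * (\<theta> \<bullet> b))\<^sup>2 / 2)\<close> over the basis, that is \<open>exp (- t\<^sup>2 / 2)\<close> for a unit vector. Levy
uniqueness therefore replaces rotation invariance.\<close>

lemma gaussian_inner_distr:
  fixes \<theta> :: "'a::euclidean_space"
  assumes "norm \<theta> = 1"
  shows "distr (density lborel (\<lambda>x::'a. ennreal (\<Prod>b\<in>Basis. std_normal_density (x \<bullet> b)))) borel (\<lambda>x. x \<bullet> \<theta>)
    = density lborel (\<lambda>x. ennreal (std_normal_density x))" (is "distr ?G borel _ = _")
proof (rule Levy_uniqueness)
  let ?g = "\<lambda>x::'a. \<Prod>b\<in>Basis. std_normal_density (x \<bullet> b)"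
  have g_meas [measurable]: "?g \<in> borel_measurable borel" by measurable
  have g_nonneg: "0 \<le> ?g x" for x by (intro prod_nonneg) auto
  have std_int: "integrable lborel std_normal_density" by (rule integrable_normal_density) simp
  have g_int: "integrable lborel ?g" by (rule integrable_lborel_prod[OF std_int])
  have "(LINT x|lborel. ?g x) = 1"
    unfolding integral_lborel_prod[OF std_int] by simp
  then have "(\<integral>\<^sup>+x. ennreal (?g x) \<partial>lborel) = 1"
    using nn_integral_eq_integral[OF g_int] g_nonneg by simp
  then have "emeasure ?G (space ?G) = 1"
    by (subst emeasure_density) (auto simp: indicator_def)
  then interpret G: prob_space ?G by (rule prob_spaceI)
  show "real_distribution (distr ?G borel (\<lambda>x. x \<bullet> \<theta>))"
    by (intro G.real_distribution_distr) simp
  show "real_distribution std_normal_distribution" by (rule real_dist_normal_dist)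
  show "char (distr ?G borel (\<lambda>x. x \<bullet> \<theta>)) = char std_normal_distribution"
  proof
    fix t
    let ?h = "\<lambda>b s. complex_of_real (std_normal_density s) * iexp (t * (\<theta> \<bullet> b) * s)"
    have h_int: "integrable lborel (?h b)" for b
    proof (rule Bochner_Integration.integrable_bound[OF std_int])
      show "AE s in lborel. norm (?h b s) \<le> norm (std_normal_density s)"
        by (intro AE_I2) (simp only: norm_mult norm_exp_i_times norm_of_real, simp)
    qed measurable
    have "char (distr ?G borel (\<lambda>x. x \<bullet> \<theta>)) t = (CLINT x|?G. iexp (t * (x \<bullet> \<theta>)))"
      unfolding char_def by (subst integral_distr) auto
    also have "\<dots> = (CLINT x|lborel. ?g x *\<^sub>R iexp (t * (x \<bullet> \<theta>)))"
      using g_nonneg by (intro integral_density) auto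
    also have "\<dots> = (CLINT x|lborel. (\<Prod>b\<in>Basis. ?h b (x \<bullet> b)))"
    proof (intro Bochner_Integration.integral_cong refl)
      fix x :: 'a
      have "t * (x \<bullet> \<theta>) = (\<Sum>b\<in>Basis. t * (\<theta> \<bullet> b) * (x \<bullet> b))"
        by (subst euclidean_inner) (simp add: sum_distrib_left mult_ac)
      then have "iexp (t * (x \<bullet> \<theta>)) = (\<Prod>b\<in>Basis. iexp (t * (\<theta> \<bullet> b) * (x \<bullet> b)))"
        by (simp add: sum_distrib_left exp_sum)
      then show "?g x *\<^sub>R iexp (t * (x \<bullet> \<theta>)) = (\<Prod>b\<in>Basis. ?h b (x \<bullet> b))"
        by (simp add: prod.distrib scaleR_conv_of_real)
    qed
    also have "\<dots> = (\<Prod>b\<in>Basis. integral\<^sup>L lborel (?h b))"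
      by (rule integral_lborel_prod[OF h_int])
    also have "\<dots> = (\<Prod>b\<in>Basis. char std_normal_distribution (t * (\<theta> \<bullet> b)))"
      unfolding char_def by (intro prod.cong refl, subst integral_density) (auto simp: scaleR_conv_of_real)
    also have "\<dots> = complex_of_real (\<Prod>b\<in>Basis. exp (- (t * (\<theta> \<bullet> b))\<^sup>2 / 2))"
      by (simp add: char_std_normal_distribution)
    also have "(\<Prod>b\<in>Basis. exp (- (t * (\<theta> \<bullet> b))\<^sup>2 / 2)) = exp (\<Sum>b\<in>Basis. - (t * (\<theta> \<bullet> b))\<^sup>2 / 2)"
      by (rule exp_sum[symmetric]) simp
    also have "(\<Sum>b\<in>Basis. - (t * (\<theta> \<bullet> b))\<^sup>2 / 2) = - (t\<^sup>2 / 2) * (\<theta> \<bullet> \<theta>)"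
      by (subst euclidean_inner) (simp add: sum_distrib_left power2_eq_square sum_negf[symmetric] mult_ac)
    also have "\<theta> \<bullet> \<theta> = 1" using assms by (simp add: norm_eq_1)
    finally show "char (distr ?G borel (\<lambda>x. x \<bullet> \<theta>)) t = char std_normal_distribution t"
      by (simp add: char_std_normal_distribution)
  qed
qed

lemma gaussian_moment_inner:
  fixes \<theta> :: "'a::euclidean_space"
  assumes "norm \<theta> = 1"
  shows "(LINT x|lborel. (x \<bullet> \<theta>) ^ (2 * j) * (\<Prod>b\<in>(Basis::'a set). std_normal_density (x \<bullet> b)))
    = fact (2 * j) / (2 ^ j * fact j)"
proof -
  let ?g = "\<lambda>x::'a. \<Prod>b\<in>Basis. std_normal_density (x \<bullet> b)"
  have "(LINT x|lborel. (x \<bullet> \<theta>) ^ (2 * j) * ?g x) = (LINT x|density lborel (\<lambda>x. ennreal (?g x)). (x \<bullet> \<theta>) ^ (2 * j))"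
    by (subst integral_density) (auto simp: mult.commute intro!: prod_nonneg)
  also have "\<dots> = (LINT s|distr (density lborel (\<lambda>x. ennreal (?g x))) borel (\<lambda>x. x \<bullet> \<theta>). s ^ (2 * j))"
    by (subst integral_distr) auto
  also have "\<dots> = (LINT s|lborel. std_normal_density s * s ^ (2 * j))"
    unfolding gaussian_inner_distr[OF assms] by (subst integral_density) auto
  also have "\<dots> = fact (2 * j) / (2 ^ j * fact j)"
    by (rule has_bochner_integral_integral_eq[OF std_normal_moment_even])
  finally show ?thesis .
qed

lemma Gamma_nat_plus_half:
  "Gamma (real k + 1 / 2) = sqrt pi * (fact (2 * k) / (2 ^ (2 * k) * fact k))"
proof (induction k)
  case 0
  show ?case by (simp add: Gamma_one_half_real)
next
  case (Suc k)
  have "Gamma (real (Suc k) + 1 / 2) = Gamma (real k + 1 / 2 + 1)" by (simp add: add_ac)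
  also have "\<dots> = (real k + 1 / 2) * Gamma (real k + 1 / 2)"
    by (rule Gamma_plus1) (auto elim!: nonpos_Ints_cases)
  also have "\<dots> = sqrt pi * (fact (2 * Suc k) / (2 ^ (2 * Suc k) * fact (Suc k)))"
  proof -
    have fs: "fact (2 * Suc k) = (2 * real k + 2) * ((2 * real k + 1) * fact (2 * k))"
      "fact (Suc k) = (real k + 1) * fact k" "2 ^ (2 * Suc k) = 4 * (2 :: real) ^ (2 * k)"
      by (simp_all add: algebra_simps)
    have alg: "(a + 1 / 2) * (p * (f / (t * g))) = p * ((2 * a + 2) * ((2 * a + 1) * f) / (4 * t * ((a + 1) * g)))"
      if "0 \<le> a" for a p f t g :: real
    proof -
      have "(2 * a + 2) * ((2 * a + 1) * f) / (4 * t * ((a + 1) * g)) = ((a + 1) * (4 * ((a + 1 / 2) * f))) / ((a + 1) * (4 * (t * g)))"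
        by (simp add: algebra_simps)
      also have "\<dots> = (a + 1 / 2) * f / (t * g)" using that by simp
      finally show ?thesis by simp
    qed
    show ?thesis unfolding Suc fs by (rule alg) simp
  qed
  finally show ?case .
qed

lemma half_gaussian_moment:
  "has_bochner_integral lborel (\<lambda>r::real. indicator {0..} r *\<^sub>R (exp (- r\<^sup>2) * r ^ k)) (Gamma ((real k + 1) / 2) / 2)"
proof (cases "even k")
  case True
  then obtain i where k: "k = 2 * i" by blast
  have half: "(real k + 1) / 2 = real i + 1 / 2" by (simp add: k)
  have "Gamma ((real k + 1) / 2) / 2 = sqrt pi / 2 * (fact (2 * i) / (2 ^ (2 * i) * fact i))"
    unfolding half Gamma_nat_plus_half by simp
  then show ?thesis using gaussian_moment_even_pos[of i] by (simp only: k)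
next
  case False
  then obtain i where k: "k = 2 * i + 1" by (elim oddE)
  have half: "(real k + 1) / 2 = 1 + real i" by (simp add: k)
  have "Gamma ((real k + 1) / 2) / 2 = fact i / 2"
    unfolding half Gamma_fact ..
  then show ?thesis using gaussian_moment_odd_pos[of i] by (simp only: k)
qed

text \<open>The substitution \<open>r = sqrt 2 * t\<close> reduces the claim to \<open>exp (- t\<^sup>2)\<close>.\<close>

lemma half_std_gaussian_moment:
  "has_bochner_integral lborel (\<lambda>r::real. indicator {0..} r * (r ^ k * exp (- r\<^sup>2 / 2)))
    (2 powr ((real k - 1) / 2) * Gamma ((real k + 1) / 2))"
proof -
  have "has_bochner_integral lborel (\<lambda>r::real. indicator {0..} (0 + (1 / sqrt 2) * r) *\<^sub>R
      (exp (- (0 + (1 / sqrt 2) * r)\<^sup>2) * (0 + (1 / sqrt 2) * r) ^ k)) ((Gamma ((real k + 1) / 2) / 2) /\<^sub>R \<bar>1 / sqrt 2\<bar>)"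
    using half_gaussian_moment[of k]
    by (subst lborel_has_bochner_integral_real_affine_iff[symmetric]) simp_all
  also have "(\<lambda>r::real. indicator {0..} (0 + (1 / sqrt 2) * r) *\<^sub>R (exp (- (0 + (1 / sqrt 2) * r)\<^sup>2) * (0 + (1 / sqrt 2) * r) ^ k))
      = (\<lambda>r. (1 / sqrt 2) ^ k * (indicator {0..} r * (r ^ k * exp (- r\<^sup>2 / 2))))"
    by (intro ext) (auto simp: indicator_def power_mult_distrib power_divide zero_le_divide_iff)
  finally have "has_bochner_integral lborel (\<lambda>r. sqrt 2 ^ k * ((1 / sqrt 2) ^ k * (indicator {0..} r * (r ^ k * exp (- r\<^sup>2 / 2)))))
      (sqrt 2 ^ k * ((Gamma ((real k + 1) / 2) / 2) /\<^sub>R \<bar>1 / sqrt 2\<bar>))"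
    by (rule has_bochner_integral_mult_right)
  moreover have "sqrt 2 ^ k * ((1 / sqrt 2) ^ k * c) = c" for c
    by (simp add: power_divide)
  moreover have "sqrt 2 ^ k * ((Gamma ((real k + 1) / 2) / 2) /\<^sub>R \<bar>1 / sqrt 2\<bar>)
      = 2 powr ((real k - 1) / 2) * Gamma ((real k + 1) / 2)"
  proof -
    have "sqrt 2 ^ Suc k / 2 = 2 powr ((real k + 1) / 2) / 2 powr 1"
      by (simp add: powr_half_sqrt[symmetric] powr_power field_simps del: power_Suc)
    also have "\<dots> = 2 powr ((real k - 1) / 2)"
    proof -
      have "(real k + 1) / 2 - 1 = (real k - 1) / 2" by (simp add: field_simps)
      then show ?thesis by (metis powr_diff)
    qed
    finally have "sqrt 2 ^ Suc k / 2 = 2 powr ((real k - 1) / 2)" .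
    then show ?thesis by (simp add: field_simps)
  qed
  ultimately show ?thesis by (simp only:)
qed

text \<open>The integral of \<open>(\<omega> \<bullet> \<theta>) ^ (2 * j)\<close> over the unit sphere of dimension \<open>n - 1\<close>, for any unit vector \<open>\<theta>\<close>.\<close>

definition sphere_moment :: "nat \<Rightarrow> nat \<Rightarrow> real" where
  "sphere_moment n j = 2 * pi powr (real n / 2) * fact (2 * j) / (4 ^ j * fact j * Gamma (real n / 2 + real j))"

text \<open>Polar coordinates hold for the homogeneous function \<open>(x \<bullet> \<theta>) ^ (2 * j)\<close> with some constant. The
Gaussian, for which both sides are known explicitly, forces the constant to be the spherical moment.\<close>

lemma has_bochner_integral_radial_moment_unit:
  fixes \<theta> :: "'a::euclidean_space" and f :: "real \<Rightarrow> real"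
  assumes \<theta>: "norm \<theta> = 1" and [measurable]: "f \<in> borel_measurable borel"
    and int: "integrable lborel (\<lambda>r. indicator {0..} r * (r ^ (DIM('a) + 2 * j - 1) * f r))"
  shows "has_bochner_integral lborel (\<lambda>x. (x \<bullet> \<theta>) ^ (2 * j) * f (norm x))
    (sphere_moment DIM('a) j * (LINT r|lborel. indicator {0..} r * (r ^ (DIM('a) + 2 * j - 1) * f r)))"
proof -
  let ?P = "\<lambda>x. (x \<bullet> \<theta>) ^ (2 * j)" and ?n = "DIM('a)" and ?N = "DIM('a) + 2 * j"
  have "(x \<bullet> \<theta>) ^ (2 * j) \<le> 1" if "norm x \<le> 1" for x
  proof -
    have "\<bar>x \<bullet> \<theta>\<bar> \<le> 1" using Cauchy_Schwarz_ineq2[of x \<theta>] that \<theta> by simp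
    then have "\<bar>x \<bullet> \<theta>\<bar> ^ (2 * j) \<le> 1" by (intro power_le_one) auto
    then show ?thesis by (simp add: power_even_abs)
  qed
  then obtain \<kappa> where "0 \<le> \<kappa>" and distr: "distr (density lborel (\<lambda>x. ennreal (?P x))) borel norm
      = density lborel (\<lambda>r. ennreal (\<kappa> * (indicator {0..} r * r ^ (?N - 1))))"
    by (rule distr_norm_homogeneous[of ?P "2 * j" 1, rotated 3]) (auto simp: power_mult_distrib)
  have polar: "has_bochner_integral lborel (\<lambda>x. ?P x * h (norm x))
      (\<kappa> * (LINT r|lborel. indicator {0..} r * (r ^ (?N - 1) * h r)))"
    if [measurable]: "h \<in> borel_measurable borel"
      and h: "integrable lborel (\<lambda>r. indicator {0..} r * (r ^ (?N - 1) * h r))" for h :: "real \<Rightarrow> real"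
  proof -
    have nn: "0 \<le> \<kappa> * (indicator {0..} r * r ^ (?N - 1))" for r
      using \<open>0 \<le> \<kappa>\<close> by (auto simp: indicator_def)
    have "has_bochner_integral lborel (\<lambda>r. (\<kappa> * (indicator {0..} r * r ^ (?N - 1))) *\<^sub>R h r)
        (\<kappa> * (LINT r|lborel. indicator {0..} r * (r ^ (?N - 1) * h r)))"
      using has_bochner_integral_mult_right[OF has_bochner_integral_integrable[OF h], of \<kappa>] by (simp add: mult_ac)
    then have "has_bochner_integral (distr (density lborel (\<lambda>x. ennreal (?P x))) borel norm) h
        (\<kappa> * (LINT r|lborel. indicator {0..} r * (r ^ (?N - 1) * h r)))"
      unfolding distr using nn by (intro has_bochner_integral_density) auto
    then have "integrable lborel (\<lambda>x. ?P x * h (norm x))"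
        "(LINT x|lborel. ?P x * h (norm x)) = \<kappa> * (LINT r|lborel. indicator {0..} r * (r ^ (?N - 1) * h r))"
      by (simp_all add: has_bochner_integral_iff integrable_distr_eq integral_distr integrable_density integral_density)
    then show ?thesis by (simp add: has_bochner_integral_iff)
  qed
  \<comment> \<open>The radial profile of the standard Gaussian density, used as the test case for \<open>\<kappa>\<close>.\<close>
  define G where "G r = (1 / sqrt (2 * pi)) ^ ?n * exp (- r\<^sup>2 / 2)" for r :: real
  have G: "G (norm x) = (\<Prod>b\<in>Basis. std_normal_density (x \<bullet> b))" for x :: 'a
  proof -
    have "(norm x)\<^sup>2 = (\<Sum>b\<in>Basis. (x \<bullet> b)\<^sup>2)"
      unfolding power2_norm_eq_inner by (subst euclidean_inner) (simp add: power2_eq_square)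
    then have "exp (- (norm x)\<^sup>2 / 2) = (\<Prod>b\<in>Basis. exp (- (x \<bullet> b)\<^sup>2 / 2))"
      by (simp add: exp_sum[symmetric] sum_negf sum_divide_distrib)
    then show ?thesis by (simp add: G_def normal_density_def prod_dividef power_divide)
  qed
  have G_mom: "has_bochner_integral lborel (\<lambda>r. indicator {0..} r * (r ^ (?N - 1) * G r))
      ((1 / sqrt (2 * pi)) ^ ?n * (2 powr ((real (?N - 1) - 1) / 2) * Gamma ((real (?N - 1) + 1) / 2)))"
    using has_bochner_integral_mult_right[OF half_std_gaussian_moment[of "?N - 1"], of "(1 / sqrt (2 * pi)) ^ ?n"]
    unfolding G_def by (simp add: mult_ac)
  have "(LINT x|lborel. ?P x * G (norm x)) = \<kappa> * (LINT r|lborel. indicator {0..} r * (r ^ (?N - 1) * G r))"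
  proof (rule has_bochner_integral_integral_eq[OF polar])
    show "G \<in> borel_measurable borel" unfolding G_def by measurable
    show "integrable lborel (\<lambda>r. indicator {0..} r * (r ^ (?N - 1) * G r))"
      using G_mom by (simp add: has_bochner_integral_iff)
  qed
  then have eq: "fact (2 * j) / (2 ^ j * fact j)
      = \<kappa> * ((1 / sqrt (2 * pi)) ^ ?n * (2 powr ((real (?N - 1) - 1) / 2) * Gamma ((real (?N - 1) + 1) / 2)))"
    unfolding G gaussian_moment_inner[OF \<theta>] has_bochner_integral_integral_eq[OF G_mom] .
  have "1 \<le> ?N" using DIM_positive[where ?'a='a] by linarith
  then have N: "real (?N - 1) = real ?n + 2 * real j - 1" by (simp add: of_nat_diff)
  have pos: "Gamma (real ?n / 2 + real j) > 0" by (intro Gamma_real_pos add_pos_nonneg) auto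
  have root: "sqrt (2 * pi) ^ ?n = 2 powr (real ?n / 2) * pi powr (real ?n / 2)"
    by (simp add: powr_half_sqrt[symmetric] powr_power powr_mult power_mult_distrib mult.commute)
  have two: "2 powr ((real ?n + 2 * real j - 1 - 1) / 2) = 2 powr (real ?n / 2) * 2 ^ j / 2"
    by (simp add: add_divide_distrib diff_divide_distrib powr_add powr_diff powr_realpow)
  have half: "(real ?n + 2 * real j - 1 + 1) / 2 = real ?n / 2 + real j" by simp
  have "fact (2 * j) / (2 ^ j * fact j)
      = \<kappa> * ((1 / (2 powr (real ?n / 2) * pi powr (real ?n / 2))) * (2 powr (real ?n / 2) * 2 ^ j / 2 * Gamma (real ?n / 2 + real j)))"
    using eq unfolding N power_one_over root two half .
  moreover have "(4::real) ^ j = 2 ^ j * 2 ^ j" by (simp flip: power_mult_distrib)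
  ultimately have "\<kappa> = sphere_moment ?n j"
    using pos unfolding sphere_moment_def by (simp add: field_simps)
  then show ?thesis using polar[of f] int by simp
qed

lemma has_bochner_integral_radial_moment:
  fixes y :: "'a::euclidean_space" and f :: "real \<Rightarrow> real"
  assumes f: "f \<in> borel_measurable borel"
    and int: "integrable lborel (\<lambda>r. indicator {0..} r * (r ^ (DIM('a) + 2 * j - 1) * f r))"
  shows "has_bochner_integral lborel (\<lambda>x. (x \<bullet> y) ^ (2 * j) * f (norm x))
    (norm y ^ (2 * j) * (sphere_moment DIM('a) j * (LINT r|lborel. indicator {0..} r * (r ^ (DIM('a) + 2 * j - 1) * f r))))"
proof -
  obtain \<theta> :: 'a where \<theta>: "norm \<theta> = 1" "y = norm y *\<^sub>R \<theta>"
  proof (cases "y = 0")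
    case True
    then show ?thesis using that[of "SOME b. b \<in> Basis"] by (simp add: norm_some_Basis)
  next
    case False
    then show ?thesis using that[of "y /\<^sub>R norm y"] by simp
  qed
  have "x \<bullet> y = norm y * (x \<bullet> \<theta>)" for x
    by (metis \<theta>(2) inner_scaleR_right)
  then have eq: "(x \<bullet> y) ^ (2 * j) * f (norm x) = norm y ^ (2 * j) * ((x \<bullet> \<theta>) ^ (2 * j) * f (norm x))" for x
    by (simp only: power_mult_distrib mult_ac)
  show ?thesis
    unfolding eq by (rule has_bochner_integral_mult_right[OF has_bochner_integral_radial_moment_unit[OF \<theta>(1) f int]])
qed

section \<open>Power series of the Fourier transform of an even function\<close>

lemma fourier_exchange:
  fixes v \<phi> :: "'a::euclidean_space \<Rightarrow> complex"
  assumes v: "integrable lborel v" and \<phi>: "integrable lborel \<phi>"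
  shows "(LINT x|lborel. v x * fourier \<phi> x) = (LINT y|lborel. fourier v y * \<phi> y)"
proof -
  let ?k = "\<lambda>x y. v x * (\<phi> y * exp (- \<i> * complex_of_real (x \<bullet> y)))"
  have [measurable]: "v \<in> borel_measurable borel" "\<phi> \<in> borel_measurable borel"
    using borel_measurable_integrable[OF v] borel_measurable_integrable[OF \<phi>] by simp_all
  have norm: "norm (?k x y) = norm (v x) * norm (\<phi> y)" for x y
    by (simp only: norm_mult norm_exp_i_real mult_1_right)
  have "integrable (lborel \<Otimes>\<^sub>M lborel) (case_prod ?k)"
  proof (rule lborel_pair.Fubini_integrable)
    show "case_prod ?k \<in> borel_measurable (lborel \<Otimes>\<^sub>M lborel)" by measurable
    show "integrable lborel (\<lambda>x. LINT y|lborel. norm (case_prod ?k (x, y)))"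
      unfolding prod.case norm using v by simp
    show "AE x in lborel. integrable lborel (\<lambda>y. case_prod ?k (x, y))"
      unfolding prod.case by (intro AE_I2 integrable_mult_right integrable_fourier_kernel \<phi>)
  qed
  from lborel_pair.Fubini_integral[OF this]
  have "(LINT y|lborel. LINT x|lborel. ?k x y) = (LINT x|lborel. LINT y|lborel. ?k x y)" .
  moreover have "(LINT y|lborel. ?k x y) = v x * fourier \<phi> x" for x
    unfolding fourier_def by (rule integral_mult_right_zero)
  moreover have "(LINT x|lborel. ?k x y) = fourier v y * \<phi> y" for y
  proof -
    have "(LINT x|lborel. ?k x y) = (LINT x|lborel. (v x * exp (- \<i> * complex_of_real (y \<bullet> x))) * \<phi> y)"
      by (intro Bochner_Integration.integral_cong) (simp_all add: inner_commute mult_ac)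
    then show ?thesis unfolding fourier_def by (simp only: integral_mult_left_zero)
  qed
  ultimately show ?thesis by (simp only:)
qed

lemma lborel_distr_reflect: "distr lborel borel uminus = (lborel :: 'a::euclidean_space measure)"
proof -
  have "(lborel :: 'a measure) = density (distr lborel borel (\<lambda>x. 0 + (- 1) *\<^sub>R x)) (\<lambda>_. ennreal (\<bar>- 1\<bar> ^ DIM('a)))"
    by (rule lborel_affine) simp
  also have "\<dots> = distr lborel borel uminus"
    by (simp add: density_1 one_ennreal_def[symmetric])
  finally show ?thesis by (rule sym)
qed

lemma fourier_even:
  fixes f :: "'a::euclidean_space \<Rightarrow> real"
  assumes f: "integrable lborel f" and even: "\<And>x. f (- x) = f x"
  shows "fourier (\<lambda>x. complex_of_real (f x)) y = complex_of_real (LINT x|lborel. f x * cos (x \<bullet> y))"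
proof -
  have [measurable]: "f \<in> borel_measurable borel" using borel_measurable_integrable[OF f] by simp
  have int_cos: "integrable lborel (\<lambda>x. f x * cos (x \<bullet> y))"
    by (rule Bochner_Integration.integrable_bound[OF f]) (auto simp: abs_mult mult_left_le)
  have int_sin: "integrable lborel (\<lambda>x. f x * sin (x \<bullet> y))"
    by (rule Bochner_Integration.integrable_bound[OF f]) (auto simp: abs_mult mult_left_le)
  have "(LINT x|lborel. f x * sin (x \<bullet> y)) = (LINT x|distr lborel borel uminus. f x * sin (x \<bullet> y))"
    unfolding lborel_distr_reflect ..
  also have "\<dots> = - (LINT x|lborel. f x * sin (x \<bullet> y))"
    by (subst integral_distr) (auto simp: even)
  finally have sin0: "(LINT x|lborel. f x * sin (x \<bullet> y)) = 0" by simp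
  have "fourier (\<lambda>x. complex_of_real (f x)) y
    = (LINT x|lborel. complex_of_real (f x * cos (x \<bullet> y)) - \<i> * complex_of_real (f x * sin (x \<bullet> y)))"
    unfolding fourier_def
  proof (intro Bochner_Integration.integral_cong refl)
    fix x
    have "exp (- \<i> * complex_of_real (y \<bullet> x)) = complex_of_real (cos (x \<bullet> y)) - \<i> * complex_of_real (sin (x \<bullet> y))"
      using exp_Euler[of "- complex_of_real (x \<bullet> y)"]
      by (simp add: inner_commute cos_of_real sin_of_real)
    then show "complex_of_real (f x) * exp (- \<i> * complex_of_real (y \<bullet> x))
      = complex_of_real (f x * cos (x \<bullet> y)) - \<i> * complex_of_real (f x * sin (x \<bullet> y))"
      by (simp only: of_real_mult) (simp add: algebra_simps)
  qed
  also have "\<dots> = complex_of_real (LINT x|lborel. f x * cos (x \<bullet> y))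
      - \<i> * complex_of_real (LINT x|lborel. f x * sin (x \<bullet> y))"
    using int_cos int_sin
    by (subst Bochner_Integration.integral_diff)
       (simp_all only: integral_complex_of_real integrable_of_real integrable_mult_right integral_mult_right_zero)
  finally show ?thesis by (simp add: sin0)
qed

lemma cosh_partial_sum_le: "(\<Sum>j<J. \<bar>t\<bar> ^ (2 * j) / fact (2 * j)) \<le> exp \<bar>t\<bar>" for t :: real
proof -
  have "(\<Sum>j<J. \<bar>t\<bar> ^ (2 * j) / fact (2 * j)) = (\<Sum>i\<in>(\<lambda>j. 2 * j) ` {..<J}. \<bar>t\<bar> ^ i / fact i)"
    by (subst sum.reindex) (auto simp: inj_on_def)
  also have "\<dots> \<le> (\<Sum>i. \<bar>t\<bar> ^ i / fact i)"
    using summable_exp[of "\<bar>t\<bar>"] by (intro sum_le_suminf) (auto simp: divide_inverse mult.commute)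
  also have "\<dots> = exp \<bar>t\<bar>"
    by (simp add: exp_def divide_inverse mult.commute)
  finally show ?thesis .
qed

text \<open>For an even function only the cosine of the Fourier kernel survives, and its Taylor series may be
integrated term by term: the sums of the absolute values are at most \<open>cosh (x \<bullet> y) \<le> exp (norm x)\<close>,
which is integrable against \<open>f\<close>. The same majorant yields absolute convergence of the resulting
series.\<close>

lemma even_fourier_power_series:
  fixes f :: "'a::euclidean_space \<Rightarrow> real"
  assumes f [measurable]: "f \<in> borel_measurable borel" and even: "\<And>x. f (- x) = f x"
    and exp_int: "integrable lborel (\<lambda>x. f x * exp (norm x))" and y: "norm y \<le> 1"
    and c: "\<And>j. has_bochner_integral lborel (\<lambda>x. (x \<bullet> y) ^ (2 * j) * f x) (c j)"
  shows "(\<lambda>j. complex_of_real ((- 1) ^ j / fact (2 * j) * c j)) sums fourier (\<lambda>x. complex_of_real (f x)) y"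
    and "summable (\<lambda>j. \<bar>(- 1) ^ j / fact (2 * j) * c j\<bar>)"
proof -
  define a where "a j x = (- 1) ^ j / fact (2 * j) * ((x \<bullet> y) ^ (2 * j) * f x)" for j x
  have a: "has_bochner_integral lborel (a j) ((- 1) ^ j / fact (2 * j) * c j)" for j
    unfolding a_def by (rule has_bochner_integral_mult_right[OF c])
  then have a_int: "integrable lborel (a j)" for j by (simp add: has_bochner_integral_iff)
  have norm_a: "norm (a j x) = \<bar>f x\<bar> * (\<bar>x \<bullet> y\<bar> ^ (2 * j) / fact (2 * j))" for j x
    by (simp add: a_def abs_mult power_abs)
  have partial: "(\<Sum>j<J. norm (a j x)) \<le> \<bar>f x\<bar> * exp (norm x)" for J x
  proof -
    have "(\<Sum>j<J. norm (a j x)) \<le> \<bar>f x\<bar> * exp \<bar>x \<bullet> y\<bar>"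
      unfolding norm_a sum_distrib_left[symmetric] by (intro mult_left_mono cosh_partial_sum_le) auto
    also have "\<bar>x \<bullet> y\<bar> \<le> norm x * 1"
      using Cauchy_Schwarz_ineq2[of x y] y by (meson mult_left_mono norm_ge_zero order_trans)
    finally show ?thesis by (simp add: mult_left_mono)
  qed
  have summ: "summable (\<lambda>j. LINT x|lborel. norm (a j x))"
  proof (rule summableI_nonneg_bounded)
    fix J
    have "(\<Sum>j<J. LINT x|lborel. norm (a j x)) = (LINT x|lborel. (\<Sum>j<J. norm (a j x)))"
      using a_int by (subst Bochner_Integration.integral_sum) auto
    also have "\<dots> \<le> (LINT x|lborel. \<bar>f x\<bar> * exp (norm x))"
      using a_int integrable_norm[OF exp_int] partial by (intro integral_mono) (auto simp: abs_mult)
    finally show "(\<Sum>j<J. LINT x|lborel. norm (a j x)) \<le> (LINT x|lborel. \<bar>f x\<bar> * exp (norm x))" .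
  qed simp
  have summ_a: "summable (\<lambda>j. norm (a j x))" for x
    by (rule summableI_nonneg_bounded[OF _ partial]) simp
  have "(\<lambda>j. LINT x|lborel. a j x) sums (LINT x|lborel. (\<Sum>j. a j x))"
    by (rule sums_integral[OF a_int AE_I2 summ]) (rule summ_a)
  moreover have "(\<Sum>j. a j x) = f x * cos (x \<bullet> y)" for x
    using sums_mult[OF cos_paired[of "x \<bullet> y"], of "f x"]
    by (simp add: a_def mult_ac sums_iff)
  ultimately have "(\<lambda>j. (- 1) ^ j / fact (2 * j) * c j) sums (LINT x|lborel. f x * cos (x \<bullet> y))"
    by (simp only: has_bochner_integral_integral_eq[OF a])
  moreover have "integrable lborel f"
  proof (rule Bochner_Integration.integrable_bound[OF exp_int])
    show "AE x in lborel. norm (f x) \<le> norm (f x * exp (norm x))"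
      by (intro AE_I2) (simp add: abs_mult mult_le_cancel_left1)
  qed simp
  ultimately show "(\<lambda>j. complex_of_real ((- 1) ^ j / fact (2 * j) * c j)) sums fourier (\<lambda>x. complex_of_real (f x)) y"
    by (simp only: fourier_even even sums_of_real_iff)
  show "summable (\<lambda>j. \<bar>(- 1) ^ j / fact (2 * j) * c j\<bar>)"
  proof (rule summable_comparison_test'[OF summ])
    fix j
    show "norm \<bar>(- 1) ^ j / fact (2 * j) * c j\<bar> \<le> (LINT x|lborel. norm (a j x))"
      using integral_norm_bound[of lborel "a j"] unfolding has_bochner_integral_integral_eq[OF a] by simp
  qed
qed

section \<open>The exponentially decaying part of the hyperbolic tangent\<close>

lemma has_bochner_integral_power_exp:
  fixes a :: real
  assumes "0 < a"
  shows "has_bochner_integral lborel (\<lambda>r. indicator {0..} r * (r ^ p * exp (- (a * r)))) (fact p / a ^ Suc p)"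
proof -
  let ?h = "\<lambda>r::real. indicator {0..} r * (r ^ p * exp (- r))"
  have "(\<integral>\<^sup>+r. ennreal (?h r) \<partial>lborel) = (\<integral>\<^sup>+r. ennreal (r ^ p * exp (- r)) * indicator {0..} r \<partial>lborel)"
    by (intro nn_integral_cong) (auto simp: indicator_def)
  also have "\<dots> = ennreal (fact p)"
    by (subst nn_intergal_power_times_exp_Ici) (simp add: ennreal_of_nat_eq_real_of_nat)
  finally have "has_bochner_integral lborel ?h (fact p)"
    by (intro has_bochner_integral_nn_integral) (auto simp: indicator_def)
  then have "has_bochner_integral lborel (\<lambda>r. ?h (0 + a * r)) (fact p /\<^sub>R \<bar>a\<bar>)"
    using assms by (subst (asm) lborel_has_bochner_integral_real_affine_iff[where c = a and t = 0]) auto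
  then have "has_bochner_integral lborel (\<lambda>r. inverse (a ^ p) * ?h (0 + a * r)) (inverse (a ^ p) * (fact p /\<^sub>R \<bar>a\<bar>))"
    by (rule has_bochner_integral_mult_right)
  moreover have "inverse (a ^ p) * ?h (0 + a * r) = indicator {0..} r * (r ^ p * exp (- (a * r)))" for r :: real
    using assms by (auto simp: indicator_def power_mult_distrib zero_le_mult_iff)
  moreover have "inverse (a ^ p) * (fact p /\<^sub>R \<bar>a\<bar>) = fact p / a ^ Suc p"
    using assms by (simp add: field_simps)
  ultimately show ?thesis by (simp only:)
qed

definition tanh_defect :: "nat \<Rightarrow> real \<Rightarrow> real" where
  "tanh_defect m r = r ^ m * tanh r - r ^ m"

lemma tanh_defect_eq: "tanh_defect m r = - (2 * r ^ m * (exp (- (2 * r)) / (1 + exp (- (2 * r)))))"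
proof -
  have "1 + exp (- (2 * r)) \<noteq> 0" using exp_gt_zero[of "- (2 * r)"] by linarith
  then show ?thesis
    unfolding tanh_defect_def tanh_real_altdef by (simp add: field_simps)
qed

lemma borel_measurable_tanh_defect [measurable]: "tanh_defect m \<in> borel_measurable borel"
  unfolding tanh_defect_eq[abs_def] by measurable

text \<open>The rate \<open>2\<close> leaves a factor \<open>exp (- r)\<close> to spare after multiplication by \<open>exp r\<close>, the majorant of
the partial sums of the cosine series on the unit ball.\<close>

lemma abs_tanh_defect_le:
  assumes "0 \<le> r"
  shows "\<bar>tanh_defect m r\<bar> \<le> 2 * (r ^ m * exp (- (2 * r)))"
proof -
  have "exp (- (2 * r)) / (1 + exp (- (2 * r))) \<le> exp (- (2 * r)) / 1"
    by (intro divide_left_mono) (auto intro: add_pos_pos)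
  then have "2 * r ^ m * (exp (- (2 * r)) / (1 + exp (- (2 * r)))) \<le> 2 * r ^ m * exp (- (2 * r))"
    using assms by (intro mult_left_mono) auto
  moreover have "0 \<le> 2 * r ^ m * (exp (- (2 * r)) / (1 + exp (- (2 * r))))"
    using assms by (intro mult_nonneg_nonneg divide_nonneg_nonneg) (auto intro: add_nonneg_nonneg)
  ultimately show ?thesis unfolding tanh_defect_eq by (simp add: mult.assoc)
qed

text \<open>The geometric series in \<open>- exp (- 2 r)\<close>; it diverges at \<open>r = 0\<close>.\<close>

lemma tanh_defect_sums:
  assumes "0 < r"
  shows "(\<lambda>k. 2 * (- 1) ^ Suc k * (r ^ m * exp (- (2 * real (Suc k) * r)))) sums tanh_defect m r"
proof -
  define q where "q = exp (- (2 * r))"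
  have q: "0 < q" "q < 1" using assms by (auto simp: q_def)
  have "(\<lambda>k. (- q) ^ k) sums (1 / (1 - (- q)))" using q by (intro geometric_sums) auto
  from sums_mult[OF this, of "2 * r ^ m * (- q)"]
  have "(\<lambda>k. 2 * r ^ m * (- q) * (- q) ^ k) sums tanh_defect m r"
    unfolding tanh_defect_eq q_def[symmetric] by simp
  moreover have "2 * r ^ m * (- q) * (- q) ^ k = 2 * (- 1) ^ Suc k * (r ^ m * exp (- (2 * real (Suc k) * r)))" for k
  proof -
    have "exp (- (2 * real (Suc k) * r)) = q ^ Suc k"
      unfolding q_def exp_of_nat_mult[symmetric] by (simp add: algebra_simps)
    then show ?thesis by (simp add: power_minus[of q])
  qed
  ultimately show ?thesis by (simp only:)
qed

text \<open>Integrating the geometric series term by term turns each exponential into a factorial over a power.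
The assumption on \<open>m\<close> enters twice: it makes the exponent of \<open>Suc k\<close> at least \<open>2\<close>, so that the
integrals of the absolute values are summable, and it makes all terms vanish at \<open>r = 0\<close>.\<close>

lemma tanh_defect_moment:
  assumes "1 \<le> m"
  shows "has_bochner_integral lborel (\<lambda>r. indicator {0..} r * (r ^ i * tanh_defect m r))
    (2 * (fact (m + i) / 2 ^ Suc (m + i)) * (\<Sum>k. (- 1) ^ Suc k / real (Suc k) ^ Suc (m + i)))"
proof -
  let ?p = "m + i"
  define a where "a k r = 2 * (- 1) ^ Suc k * (indicator {0..} r * (r ^ ?p * exp (- (2 * real (Suc k) * r))))" for k r
  have a: "has_bochner_integral lborel (a k) (2 * (- 1) ^ Suc k * (fact ?p / (2 * real (Suc k)) ^ Suc ?p))" for k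
    unfolding a_def by (intro has_bochner_integral_mult_right has_bochner_integral_power_exp) simp
  have norm_int: "has_bochner_integral lborel (\<lambda>r. norm (a k r)) (2 * (fact ?p / (2 * real (Suc k)) ^ Suc ?p))" for k
  proof -
    have "norm (a k r) = 2 * (indicator {0..} r * (r ^ ?p * exp (- (2 * real (Suc k) * r))))" for r
      by (auto simp: a_def abs_mult indicator_def)
    then show ?thesis
      by (simp only:) (intro has_bochner_integral_mult_right has_bochner_integral_power_exp, simp)
  qed
  have norm_a: "(LINT r|lborel. norm (a k r)) = 2 * fact ?p / 2 ^ Suc ?p * inverse (real (Suc k) ^ Suc ?p)" for k
    unfolding has_bochner_integral_integral_eq[OF norm_int]
    by (simp only: power_mult_distrib divide_inverse inverse_mult_distrib mult.assoc)
  have "summable (\<lambda>k. inverse (real (Suc k) ^ Suc ?p))"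
    using inverse_power_summable[of "Suc ?p", where ?'a = real] assms
    by (subst summable_Suc_iff[of "\<lambda>k. inverse (real k ^ Suc ?p)"]) simp
  then have summ: "summable (\<lambda>k. LINT r|lborel. norm (a k r))"
    unfolding norm_a by (rule summable_mult)
  have pt: "a k r = indicator {0..} r * (r ^ i * (2 * (- 1) ^ Suc k * (r ^ m * exp (- (2 * real (Suc k) * r)))))" for k r
    by (simp add: a_def power_add mult_ac)
  have sums: "(\<lambda>k. a k r) sums (indicator {0..} r * (r ^ i * tanh_defect m r))" for r
  proof (cases "0 < r")
    case True
    then show ?thesis unfolding pt by (intro sums_mult tanh_defect_sums)
  next
    case False
    then have "a k r = 0" "indicator {0..} r * (r ^ i * tanh_defect m r) = 0" for k
      using assms by (auto simp: a_def tanh_defect_def indicator_def)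
    then show ?thesis by (simp only: sums_zero)
  qed
  have summ_a: "summable (\<lambda>k. norm (a k r))" for r
  proof (cases "0 < r")
    case True
    have "norm (a k r) = 2 * r ^ ?p * exp (- (2 * r)) * exp (- (2 * r)) ^ k" for k
      using True by (simp add: a_def abs_mult exp_of_nat_mult[symmetric] exp_add[symmetric] algebra_simps)
    moreover have "summable (\<lambda>k. exp (- (2 * r)) ^ k)" using True by (intro summable_geometric) simp
    ultimately show ?thesis by (simp only: summable_mult)
  next
    case False
    then have "a k r = 0" for k using assms by (auto simp: a_def indicator_def)
    then show ?thesis by simp
  qed
  have a_int: "integrable lborel (a k)" for k using a by (simp add: has_bochner_integral_iff)
  have suminf: "(\<Sum>k. a k r) = indicator {0..} r * (r ^ i * tanh_defect m r)" for r
    using sums by (simp add: sums_iff)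
  have 1: "integrable lborel (\<lambda>r. \<Sum>k. a k r)"
    by (rule integrable_suminf[OF a_int AE_I2 summ]) (rule summ_a)
  have 2: "(LINT r|lborel. (\<Sum>k. a k r)) = (\<Sum>k. LINT r|lborel. a k r)"
    by (rule integral_suminf[OF a_int AE_I2 summ]) (rule summ_a)
  have 3: "(LINT r|lborel. a k r) = 2 * (fact ?p / 2 ^ Suc ?p) * ((- 1) ^ Suc k / real (Suc k) ^ Suc ?p)" for k
    unfolding has_bochner_integral_integral_eq[OF a]
    by (simp only: power_mult_distrib divide_inverse inverse_mult_distrib mult_ac)
  have "summable (\<lambda>k. (- 1) ^ Suc k / real (Suc k) ^ Suc ?p)"
    using \<open>summable (\<lambda>k. inverse (real (Suc k) ^ Suc ?p))\<close>
    by (rule summable_comparison_test') (simp add: divide_inverse abs_mult)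
  from suminf_mult[OF this] have "(\<Sum>k. LINT r|lborel. a k r)
      = 2 * (fact ?p / 2 ^ Suc ?p) * (\<Sum>k. (- 1) ^ Suc k / real (Suc k) ^ Suc ?p)"
    unfolding 3 .
  with 1 2 show ?thesis unfolding suminf by (simp only: has_bochner_integral_iff) 
qed

lemma real_Gamma_duplication:
  fixes z :: real
  assumes "0 < z"
  shows "Gamma z * Gamma (z + 1 / 2) = 2 powr (1 - 2 * z) * sqrt pi * Gamma (2 * z)"
proof -
  have nonpos: "complex_of_real t \<notin> \<int>\<^sub>\<le>\<^sub>0" if "0 < t" for t
    using that by (auto elim!: nonpos_Ints_cases simp: complex_eq_iff)
  have "complex_of_real (Gamma z * Gamma (z + 1 / 2))
      = Gamma (complex_of_real z) * Gamma (complex_of_real z + 1 / 2)"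
    by (simp flip: Gamma_complex_of_real)
  also have "\<dots> = exp ((1 - 2 * complex_of_real z) * of_real (ln 2)) * of_real (sqrt pi) * Gamma (2 * complex_of_real z)"
    using nonpos[of z] nonpos[of "z + 1 / 2"] assms by (intro Gamma_legendre_duplication) auto
  also have "\<dots> = complex_of_real (exp ((1 - 2 * z) * ln 2) * sqrt pi * Gamma (2 * z))"
    by (simp flip: Gamma_complex_of_real exp_of_real)
  finally show ?thesis by (simp only: of_real_eq_iff powr_def) simp
qed

text \<open>The factorial splits as \<open>fact (n + 2 * j - 1)\<close> times the product over \<open>i < m\<close> in the coefficient.
Legendre duplication at \<open>z = n / 2 + j\<close> then trades that factorial and the \<open>Gamma z\<close> of the spherical
moment for the factor \<open>Gamma (z + 1 / 2)\<close>; the remaining powers of \<open>2\<close> and \<open>pi\<close> give the constant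
in front.\<close>

lemma expansion_coeff_eq_moment:
  assumes "1 \<le> n"
  shows "(- 1) ^ j / fact (2 * j) * (sphere_moment n j *
      (2 * (fact (m + (n + 2 * j - 1)) / 2 ^ Suc (m + (n + 2 * j - 1))) * (\<Sum>k. (- 1) ^ Suc k / real (Suc k) ^ Suc (m + (n + 2 * j - 1)))))
    = 2 powr (1 - real m) * pi powr ((real n - 1) / 2) * expansion_coeff n m j"
proof -
  define z where "z = real n / 2 + real j"
  have z: "0 < z" using assms by (simp add: z_def add_pos_nonneg)
  obtain p where p: "n + 2 * j = Suc p" using assms by (cases "n + 2 * j") auto
  have e: "Suc (m + (n + 2 * j - 1)) = m + 2 * j + n" "m + (n + 2 * j - 1) = m + p" using p by auto
  define S where "S = (\<Sum>k. (- 1) ^ Suc k / real (Suc k) ^ (m + 2 * j + n))"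
  define Q where "Q = (\<Prod>i<m. real (n + 2 * j + i))"
  have fact: "fact (m + p) = fact p * Q"
  proof -
    have "fact (m' + p) = fact p * (\<Prod>i<m'. real (n + 2 * j + i))" for m'
      unfolding p by (induction m') (simp_all add: algebra_simps)
    then show ?thesis unfolding Q_def .
  qed
  have "2 * z = real (n + 2 * j)" by (simp add: z_def)
  then have 2: "2 * z = 1 + real p" unfolding p by simp
  have "Gamma z * Gamma (z + 1 / 2) = 2 powr (- real p) * sqrt pi * fact p"
    using real_Gamma_duplication[OF z] unfolding 2 Gamma_fact by simp
  then have dup: "fact p = Gamma z * Gamma (z + 1 / 2) * 2 ^ p / sqrt pi"
    by (simp add: powr_minus powr_realpow field_simps)
  have "pi powr (real n / 2) = pi powr ((real n - 1) / 2) * pi powr (1 / 2)"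
    unfolding powr_add[symmetric] by (simp add: field_simps)
  then have pi: "pi powr (real n / 2) = pi powr ((real n - 1) / 2) * sqrt pi"
    by (simp add: powr_half_sqrt)
  have 4: "(4::real) ^ j = 2 ^ (2 * j)" by (simp add: power_mult)
  have m2: "2 powr (1 - real m) = 2 / 2 ^ m" by (simp add: powr_diff powr_realpow)
  have mp: "(2::real) ^ (m + 2 * j + n) = 2 * (2 ^ m * 2 ^ p)"
  proof -
    have "m + 2 * j + n = Suc (m + p)" using p by simp
    then show ?thesis by (simp only: power_add power_Suc)
  qed
  have G: "Gamma (real j + (real n + 1) / 2) = Gamma (z + 1 / 2)"
    by (rule arg_cong[of _ _ Gamma]) (simp add: z_def field_simps)
  have Gpos: "Gamma z > 0" by (rule Gamma_real_pos[OF z])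
  show ?thesis
    unfolding expansion_coeff_def sphere_moment_def e(1) S_def[symmetric] unfolding e(2) Q_def[symmetric] z_def[symmetric] G fact pi m2 4
    unfolding mp dup using Gpos by (simp add: field_simps)
qed

theorem theorem1:
  fixes m :: nat and g u :: "real ^ 'n \<Rightarrow> real"
  assumes "m \<ge> 1"
    and "\<And>x. g x = norm x ^ m * tanh (norm x)"
    and "\<And>x. u x = norm x ^ m"
  shows "(\<forall>y :: real ^ 'n. norm y < 1 \<longrightarrow>
            summable (\<lambda>j. \<bar>expansion_coeff CARD('n) m j * norm y ^ (2 * j)\<bar>)) \<and>
         has_generalised_fourier (\<lambda>x. complex_of_real (u x)) \<and>
         has_generalised_fourier (\<lambda>x. complex_of_real (g x)) \<and>
         distributions_eq_on (ball 0 1)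
           (generalised_fourier (\<lambda>x. complex_of_real (g x)))
           (\<lambda>\<phi>. generalised_fourier (\<lambda>x. complex_of_real (u x)) \<phi>
              + regular_distribution
                  (\<lambda>y. complex_of_real
                     (2 powr (1 - real m) * pi powr ((real CARD('n) - 1) / 2)
                      * (\<Sum>j. expansion_coeff CARD('n) m j * norm y ^ (2 * j)))) \<phi>)"
proof -
  let ?n = "CARD('n)" and ?K = "2 powr (1 - real m) * pi powr ((real CARD('n) - 1) / 2)"
  define w where "w x = tanh_defect m (norm x)" for x :: "real ^ 'n"
  define c where "c y j = norm y ^ (2 * j) * (sphere_moment ?n j * (2 * (fact (m + (?n + 2 * j - 1)) / 2 ^ Suc (m + (?n + 2 * j - 1)))
      * (\<Sum>k. (- 1) ^ Suc k / real (Suc k) ^ Suc (m + (?n + 2 * j - 1)))))" for y :: "real ^ 'n" and j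
  have n: "1 \<le> ?n" by (simp add: Suc_le_eq)
  have K: "0 < ?K" by simp
  have [measurable]: "w \<in> borel_measurable borel" unfolding w_def by measurable
  \<comment> \<open>The plain radial integral is the moment formula for the exponent \<open>0\<close> and the zero vector,
      since \<open>0 ^ 0 = 1\<close>.\<close>
  have w_exp: "integrable lborel (\<lambda>x. w x * exp (norm x))"
  proof (rule Bochner_Integration.integrable_bound)
    have "integrable lborel (\<lambda>r::real. indicator {0..} r * (r ^ (?n + m - 1) * exp (- (1 * r))))"
      using has_bochner_integral_power_exp[of 1 "?n + m - 1"] by (simp only: has_bochner_integral_iff zero_less_one)
    then have "integrable lborel (\<lambda>r::real. indicator {0..} r * (r ^ (?n + 2 * 0 - 1) * (r ^ m * exp (- r))))"
      using n by (simp add: power_add[symmetric] mult.assoc[symmetric])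
    then show "integrable lborel (\<lambda>x::real ^ 'n. 2 * ((x \<bullet> 0) ^ (2 * 0) * (norm x ^ m * exp (- norm x))))"
      using has_bochner_integral_radial_moment[of "\<lambda>r. r ^ m * exp (- r)" 0 "0::real ^ 'n"]
      by (intro integrable_mult_right) (simp add: has_bochner_integral_iff)
    show "AE x in lborel. norm (w x * exp (norm x)) \<le> norm (2 * (((x::real ^ 'n) \<bullet> 0) ^ (2 * 0) * (norm x ^ m * exp (- norm x))))"
    proof (rule AE_I2)
      fix x :: "real ^ 'n"
      have "norm (w x * exp (norm x)) \<le> 2 * (norm x ^ m * exp (- (2 * norm x))) * exp (norm x)"
        unfolding norm_mult w_def by (intro mult_mono) (use abs_tanh_defect_le[of "norm x" m] in auto)
      also have "\<dots> = 2 * (norm x ^ m * exp (- norm x))"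
        by (simp add: mult.assoc exp_add[symmetric])
      finally show "norm (w x * exp (norm x)) \<le> norm (2 * ((x \<bullet> 0) ^ (2 * 0) * (norm x ^ m * exp (- norm x))))"
        by simp
    qed
  qed measurable
  have w_mom: "has_bochner_integral lborel (\<lambda>x. (x \<bullet> y) ^ (2 * j) * w x) (c y j)" for y j
  proof -
    note mom = tanh_defect_moment[OF assms(1), of "?n + 2 * j - 1"]
    have "integrable lborel (\<lambda>r. indicator {0..} r * (r ^ (?n + 2 * j - 1) * tanh_defect m r))"
      using mom by (simp only: has_bochner_integral_iff)
    from has_bochner_integral_radial_moment[of "tanh_defect m" j y] this show ?thesis
      unfolding w_def c_def by (simp only: DIM_cart DIM_real mult_1_right borel_measurable_tanh_defect simp_thms True_implies_equals
          has_bochner_integral_integral_eq[OF mom])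
  qed
  have coeff: "(- 1) ^ j / fact (2 * j) * c y j = ?K * (expansion_coeff ?n m j * norm y ^ (2 * j))" for y :: "real ^ 'n" and j
  proof -
    have "(- 1) ^ j / fact (2 * j) * c y j = (?K * expansion_coeff ?n m j) * norm y ^ (2 * j)"
      unfolding expansion_coeff_eq_moment[OF n, symmetric] c_def by (simp only: mult_ac)
    then show ?thesis by (simp only: mult_ac)
  qed
  have even: "w (- x) = w x" for x by (simp add: w_def)
  have summ: "summable (\<lambda>j. \<bar>expansion_coeff ?n m j * norm y ^ (2 * j)\<bar>)" if "norm y < 1" for y :: "real ^ 'n"
  proof -
    have "summable (\<lambda>j. \<bar>?K * (expansion_coeff ?n m j * norm y ^ (2 * j))\<bar>)"
      using even_fourier_power_series(2)[OF _ even w_exp _ w_mom, of y] that unfolding coeff by simp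
    then have "summable (\<lambda>j. inverse ?K * \<bar>?K * (expansion_coeff ?n m j * norm y ^ (2 * j))\<bar>)"
      by (rule summable_mult)
    moreover have "inverse ?K * \<bar>?K * t\<bar> = \<bar>t\<bar>" for t
      using K by (simp only: abs_mult abs_of_pos) (simp add: field_simps)
    ultimately show ?thesis by (simp only:)
  qed
  have series: "fourier (\<lambda>x. complex_of_real (w x)) y
      = complex_of_real (?K * (\<Sum>j. expansion_coeff ?n m j * norm y ^ (2 * j)))" if "norm y < 1" for y
  proof -
    have "(\<lambda>j. complex_of_real (?K * (expansion_coeff ?n m j * norm y ^ (2 * j)))) sums fourier (\<lambda>x. complex_of_real (w x)) y"
      using even_fourier_power_series(1)[OF _ even w_exp _ w_mom, of y] that unfolding coeff by simp
    moreover have "(\<lambda>j. ?K * (expansion_coeff ?n m j * norm y ^ (2 * j))) sums (?K * (\<Sum>j. expansion_coeff ?n m j * norm y ^ (2 * j)))"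
      by (rule sums_mult[OF summable_sums[OF summable_rabs_cancel[OF summ[OF that]]]])
    ultimately show ?thesis by (rule sums_unique2[OF _ sums_of_real])
  qed
  have w_int: "integrable lborel (\<lambda>x. complex_of_real (w x))"
  proof -
    have "integrable lborel w"
    proof (rule Bochner_Integration.integrable_bound[OF w_exp])
      show "AE x in lborel. norm (w x) \<le> norm (w x * exp (norm x))"
        by (intro AE_I2) (simp add: abs_mult mult_le_cancel_left1)
    qed simp
    then show ?thesis by (rule integrable_of_real)
  qed
  have u_meas: "(\<lambda>x. complex_of_real (u x)) \<in> borel_measurable borel"
    unfolding assms(3) by measurable
  have g_eq: "g x = u x + w x" for x by (simp add: assms w_def tanh_defect_def)
  have g_meas: "(\<lambda>x. complex_of_real (g x)) \<in> borel_measurable borel"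
    unfolding g_eq assms(3) by measurable
  have u_growth: "norm (complex_of_real (u x)) \<le> 1 * (1 + norm x ^ m)" for x
    by (simp add: assms(3) norm_power)
  have g_growth: "norm (complex_of_real (g x)) \<le> 1 * (1 + norm x ^ m)" for x
  proof -
    have "\<bar>tanh (norm x)\<bar> \<le> 1" using tanh_real_bounds[of "norm x"] by auto
    then have "norm x ^ m * \<bar>tanh (norm x)\<bar> \<le> norm x ^ m * 1" by (intro mult_left_mono) auto
    then show ?thesis by (simp add: assms(2) norm_mult abs_mult norm_power)
  qed
  have "generalised_fourier (\<lambda>x. complex_of_real (g x)) \<phi>
      = generalised_fourier (\<lambda>x. complex_of_real (u x)) \<phi>
        + regular_distribution (\<lambda>y. complex_of_real (?K * (\<Sum>j. expansion_coeff ?n m j * norm y ^ (2 * j)))) \<phi>"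
    if \<phi>: "\<phi> \<in> test_functions (ball 0 1)" for \<phi> :: "real ^ 'n \<Rightarrow> complex"
  proof -
    have \<phi>S: "\<phi> \<in> schwartz_space" using \<phi> test_functions_subset_schwartz by blast
    have "generalised_fourier (\<lambda>x. complex_of_real (g x)) \<phi> - generalised_fourier (\<lambda>x. complex_of_real (u x)) \<phi>
      = (LINT x|lborel. complex_of_real (g x) * fourier \<phi> x - complex_of_real (u x) * fourier \<phi> x)"
      unfolding generalised_fourier_def fourier_distribution_def regular_distribution_def
      by (rule Bochner_Integration.integral_diff[symmetric]; rule integrable_growth_times_fourier)
         (rule g_meas u_meas g_growth u_growth \<phi>S)+
    also have "\<dots> = (LINT x|lborel. complex_of_real (w x) * fourier \<phi> x)"
      by (simp add: g_eq algebra_simps)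
    also have "\<dots> = (LINT y|lborel. fourier (\<lambda>x. complex_of_real (w x)) y * \<phi> y)"
      by (rule fourier_exchange[OF w_int schwartz_integrable[OF \<phi>S]])
    also have "\<dots> = regular_distribution (\<lambda>y. complex_of_real (?K * (\<Sum>j. expansion_coeff ?n m j * norm y ^ (2 * j)))) \<phi>"
      unfolding regular_distribution_def
    proof (intro Bochner_Integration.integral_cong refl)
      fix y
      show "fourier (\<lambda>x. complex_of_real (w x)) y * \<phi> y
        = complex_of_real (?K * (\<Sum>j. expansion_coeff ?n m j * norm y ^ (2 * j))) * \<phi> y"
      \<comment> \<open>The series is only known to represent the transform on the ball; elsewhere \<open>\<phi>\<close> vanishes.\<close>
      proof (cases "\<phi> y = 0")
        case False
        then have "y \<in> ball 0 1"
          using \<phi> closure_subset[of "{x. \<phi> x \<noteq> 0}"] by (auto simp: test_functions_def)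
        then show ?thesis by (simp only: series mem_ball_0)
      qed simp
    qed
    finally show ?thesis by (simp only: diff_eq_eq add.commute)
  qed
  then have "distributions_eq_on (ball 0 1) (generalised_fourier (\<lambda>x. complex_of_real (g x)))
      (\<lambda>\<phi>. generalised_fourier (\<lambda>x. complex_of_real (u x)) \<phi>
        + regular_distribution (\<lambda>y. complex_of_real (?K * (\<Sum>j. expansion_coeff ?n m j * norm y ^ (2 * j)))) \<phi>)"
    unfolding distributions_eq_on_def by (intro ballI)
  then show ?thesis
    by (intro conjI allI impI summ polynomial_growth_has_generalised_fourier[OF u_meas u_growth]
        polynomial_growth_has_generalised_fourier[OF g_meas g_growth])
qed

end
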